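(* Let $n\ge 1$, $T>0$, and suppose: $\ell:\mathbb{R}^n\to\mathbb{R}$ is $C^2$, strictly convex, and $\lim_{|u|\to\infty}\ell(u)/|u|=\infty$; $g:\mathbb{R}^n\to\mathbb{R}$ is globally Lipschitz; $d:[0,T]\times[0,T]\to(a,1]$, $(t,s)\mapsto d_t(s)$, with $a>0$, is Lipschitz continuous with $d_t(t)=1$ for each $t$. Let $\iota=(\nabla\ell)^{-1}$. If $x\in\mathbb{R}^n$ and $0\le t<T$, then the value function $$v(x,t)=\inf_{y\in \mathrm{AC}_{x,t}}\left\{\int_t^T d_t(s)\,\ell(\dot y(s))\,ds+d_t(T)\,g(y(T))\right\}$$ is given by $$v(x,t)=\min_{p\in\mathbb{R}^n}\left\{\int_t^T d_t(s)\,\ell\big(\iota(d_t^{-1}(s)p)\big)\,ds+d_t(T)\,g\Big(x+\int_t^T\iota(d_t^{-1}(s)p)\,ds\Big)\right\},$$ where in particular the minimum is attained.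
   Context: $\mathrm{AC}_{x,t}$ is the set of absolutely continuous $y:[t,T]\to\mathbb{R}^n$ with $y(t)=x$. $d_t^{-1}(s)$ means $1/d_t(s)$. Under the assumptions on $\ell$, $\nabla\ell:\mathbb{R}^n\to\mathbb{R}^n$ is a bijection and $\iota$ denotes its inverse function. Only the values $d_t(s)$ with $t\le s$ enter. *)

theory Defs
  imports "HOL-Analysis.Analysis"
begin

definition twice_continuously_differentiable ::
    "('a::real_normed_vector \<Rightarrow> 'b::real_normed_vector) \<Rightarrow> bool" where
  "twice_continuously_differentiable f \<longleftrightarrow>
     (\<exists>f' f''. (\<forall>x. (f has_derivative blinfun_apply (f' x)) (at x)) \<and>
               (\<forall>x. (f' has_derivative blinfun_apply (f'' x)) (at x)) \<and>
               continuous_on UNIV f'')"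

definition strictly_convex :: "('a::real_vector \<Rightarrow> real) \<Rightarrow> bool" where
  "strictly_convex f \<longleftrightarrow>
     (\<forall>x y u. x \<noteq> y \<longrightarrow> 0 < u \<longrightarrow> u < 1 \<longrightarrow>
        f ((1 - u) *\<^sub>R x + u *\<^sub>R y) < (1 - u) * f x + u * f y)"

definition gradient :: "('a::real_inner \<Rightarrow> real) \<Rightarrow> 'a \<Rightarrow> 'a" where
  "gradient f x = (THE D. GDERIV f x :> D)"

text \<open>The usual epsilon-delta definition of absolute continuity on a set of reals. A finite family
  of nonoverlapping compact intervals is a division of its union; its member \<open>{u..v}\<close> has
  endpoints \<open>Inf {u..v} = u\<close> and \<open>Sup {u..v} = v\<close>.\<close>

definition absolutely_continuous_on :: "real set \<Rightarrow> (real \<Rightarrow> 'a::real_normed_vector) \<Rightarrow> bool" where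
  "absolutely_continuous_on S y \<longleftrightarrow>
     (\<forall>\<epsilon>>0. \<exists>\<delta>>0. \<forall>D. D division_of \<Union>D \<longrightarrow> \<Union>D \<subseteq> S \<longrightarrow>
        (\<Sum>k\<in>D. Sup k - Inf k) < \<delta> \<longrightarrow> (\<Sum>k\<in>D. norm (y (Sup k) - y (Inf k))) < \<epsilon>)"

text \<open>Curves are total functions; their values outside \<open>{t..T}\<close> never matter.\<close>

definition AC :: "real \<Rightarrow> 'a::real_normed_vector \<Rightarrow> real \<Rightarrow> (real \<Rightarrow> 'a) set" where
  "AC T x t = {y. absolutely_continuous_on {t..T} y \<and> y t = x}"

text \<open>The Lebesgue integral with values in the extended reals. It is meaningful when the negative
  part has finite integral, e.g. for integrands bounded below on a bounded set. A curve of infinite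
  running cost thus gets cost \<open>\<infinity>\<close>, whereas the Bochner integral would assign it the value \<open>0\<close>.\<close>

definition ext_lebesgue_integral :: "real set \<Rightarrow> (real \<Rightarrow> real) \<Rightarrow> ereal" where
  "ext_lebesgue_integral S f =
     enn2ereal (\<integral>\<^sup>+ s\<in>S. ennreal (f s) \<partial>lebesgue) - enn2ereal (\<integral>\<^sup>+ s\<in>S. ennreal (- f s) \<partial>lebesgue)"

text \<open>An absolutely continuous curve is differentiable only almost everywhere; on the remaining null
  set \<open>vector_derivative\<close> is an arbitrary value that does not affect the integral.\<close>

definition cost ::
    "real \<Rightarrow> ('a::real_normed_vector \<Rightarrow> real) \<Rightarrow> ('a \<Rightarrow> real) \<Rightarrow> (real \<Rightarrow> real \<Rightarrow> real) \<Rightarrow> real \<Rightarrow>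
     (real \<Rightarrow> 'a) \<Rightarrow> ereal" where
  "cost T l g d t y =
     ext_lebesgue_integral {t..T} (\<lambda>s. d t s * l (vector_derivative y (at s within {t..T}))) +
     ereal (d t T * g (y T))"

definition value_function ::
    "real \<Rightarrow> ('a::real_normed_vector \<Rightarrow> real) \<Rightarrow> ('a \<Rightarrow> real) \<Rightarrow> (real \<Rightarrow> real \<Rightarrow> real) \<Rightarrow> 'a \<Rightarrow>
     real \<Rightarrow> ereal" where
  "value_function T l g d x t = (INF y\<in>AC T x t. cost T l g d t y)"

definition hopf_lax_objective ::
    "real \<Rightarrow> (real ^ 'n \<Rightarrow> real) \<Rightarrow> (real ^ 'n \<Rightarrow> real) \<Rightarrow> (real \<Rightarrow> real \<Rightarrow> real) \<Rightarrow> real ^ 'n \<Rightarrow>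
     real \<Rightarrow> real ^ 'n \<Rightarrow> real" where
  "hopf_lax_objective T l g d x t p =
     (let \<iota> = inv (gradient l) in
        (LINT s:{t..T}|lebesgue. d t s * l (\<iota> (inverse (d t s) *\<^sub>R p))) +
        d t T * g (x + (LINT s:{t..T}|lebesgue. \<iota> (inverse (d t s) *\<^sub>R p))))"

end

theory Submission
  imports Defs
begin

text \<open>Write \<open>\<delta> s = d t s\<close>, let \<open>u\<^sub>p s = \<iota> (p / \<delta> s)\<close> and let \<open>\<Phi> p\<close> be the integral of \<open>u\<^sub>p\<close>.
  Since \<open>p / \<delta> s\<close> is the gradient of \<open>l\<close> at \<open>u\<^sub>p s\<close>, convexity gives
  \<open>\<delta> l(y') \<ge> \<delta> l(u\<^sub>p) + p \<bullet> (y' - u\<^sub>p)\<close> along every curve \<open>y\<close>. If \<open>\<Phi> p = y T - x\<close> the last term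
  integrates to zero, so the curve with velocity \<open>u\<^sub>p\<close> is at least as cheap as \<open>y\<close>. Such a \<open>p\<close> always
  exists, because \<open>\<Phi>\<close> is continuous and \<open>\<Phi> p \<bullet> p\<close> grows superlinearly, which by Brouwer's theorem
  implies surjectivity; the same argument inverts the gradient of \<open>l\<close>. The minimum over \<open>p\<close> is attained
  because the objective is continuous and coercive. The integration step needs the fundamental
  theorem of calculus for absolutely continuous curves: differentiability almost everywhere comes
  from Vitali's covering theorem, and the integral of the derivative from a gauge that confines the
  tags in the exceptional null set to an open set of small measure.\<close>

subsection \<open>Absolutely continuous functions\<close>

text \<open>Extending \<open>p\<close> by further intervals \<open>c\<close> to a division of a box
  makes \<open>q \<union> c\<close> a division of the same box. Both extended sums telescope to
  \<open>f b - f a\<close>, and the common part over \<open>c\<close> cancels.\<close>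

lemma sum_increments_division_unique:
  fixes f :: "real \<Rightarrow> 'a::real_normed_vector"
  assumes p: "p division_of S" and q: "q division_of S"
  shows "(\<Sum>k\<in>p. f (Sup k) - f (Inf k)) = (\<Sum>k\<in>q. f (Sup k) - f (Inf k))"
proof -
  obtain a b where S: "S \<subseteq> cbox a b"
    using elementary_subset_cbox[OF p] by blast
  show ?thesis
  proof (cases "S = {}")
    case True
    then show ?thesis using p q by simp
  next
    case False
    then have ab: "a \<le> b" using S by auto
    then have "{cbox a b} division_of cbox a b" by (intro division_of_self) auto
    from partial_division_extend[OF p this S]
    obtain r where r: "p \<subseteq> r" "r division_of cbox a b" by blast
    define c where "c = r - p"
    have fin: "finite p" "finite q" "finite c" using p q r c_def by auto
    have total: "(\<Sum>k\<in>d. f (Sup k) - f (Inf k)) = f b - f a" if d: "d division_of cbox a b" for d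
    proof -
      \<comment> \<open>Left endpoints serve as tags, so that telescoping for tagged divisions
        applies.\<close>
      have "(\<lambda>k. (Inf k, k)) ` d tagged_division_of {a..b}"
      proof (rule tagged_division_ofI)
        fix x k assume "(x, k) \<in> (\<lambda>k. (Inf k, k)) ` d"
        then have k: "k \<in> d" "x = Inf k" by auto
        with division_ofD(3,4)[OF d] obtain u v where "k = cbox u v" "k \<noteq> {}" by metis
        then show "x \<in> k" "\<exists>a b. k = cbox a b" using k by auto
        show "k \<subseteq> {a..b}" using division_ofD(2)[OF d k(1)] by simp
      next
        show "\<Union>{k. \<exists>x. (x, k) \<in> (\<lambda>k. (Inf k, k)) ` d} = {a..b}"
          using division_ofD(6)[OF d] by (simp add: image_iff Setcompr_eq_image flip: ex_simps)
      qed (use d division_ofD(5)[OF d] in auto)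
      from additive_tagged_division_1[OF ab this, of f]
      show ?thesis by (simp add: sum.reindex inj_on_def)
    qed
    have cdiv: "c division_of \<Union>c"
      using division_of_subset[of r c] r division_ofD(6)[OF r(2)] by (simp add: c_def)
    have disj: "interior k \<inter> interior S = {}" if "k \<in> c" for k
    proof -
      have "interior k \<inter> interior (\<Union>p) = {}"
      proof (rule Int_interior_Union_intervals)
        fix T assume "T \<in> p"
        then show "interior k \<inter> interior T = {}"
          using that r division_ofD(5)[OF r(2)] unfolding c_def by (metis DiffE subsetD)
      qed (use p division_ofD(4)[OF p] in auto)
      then show ?thesis using division_ofD(6)[OF p] by simp
    qed
    have SC: "interior S \<inter> interior (\<Union>c) = {}"
    proof (rule Int_interior_Union_intervals)
      show "\<And>T. T \<in> c \<Longrightarrow> interior S \<inter> interior T = {}" using disj by blast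
    qed (use fin division_ofD(4)[OF cdiv] in auto)
    have U: "S \<union> \<Union>c = cbox a b"
      using r division_ofD(6)[OF r(2)] division_ofD(6)[OF p] unfolding c_def by blast
    have qc: "q \<union> c division_of cbox a b"
      using division_disjoint_union[OF q cdiv SC] U by simp
    \<comment> \<open>Only degenerate intervals can belong to both \<open>q\<close> and
      \<open>c\<close>, so the sum over the union still splits.\<close>
    have zero: "f (Sup k) - f (Inf k) = 0" if kq: "k \<in> q" and kc: "k \<in> c" for k
    proof -
      obtain u v where k: "k = cbox u v" "k \<noteq> {}"
        using division_ofD(3,4)[OF q kq] by metis
      have "interior k \<subseteq> interior S"
        by (rule interior_mono) (use division_ofD(2)[OF q kq] in auto)
      with disj[OF kc] have "interior k = {}" by auto
      with k have "u = v" by auto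
      with k show ?thesis by simp
    qed
    have "(\<Sum>k\<in>p. f (Sup k) - f (Inf k)) + (\<Sum>k\<in>c. f (Sup k) - f (Inf k)) = f b - f a"
      using total[OF r(2)] sum.subset_diff[OF r(1), of "\<lambda>k. f (Sup k) - f (Inf k)"] r(2)
      by (simp add: c_def add.commute division_of_finite)
    moreover have "(\<Sum>k\<in>q. f (Sup k) - f (Inf k)) + (\<Sum>k\<in>c. f (Sup k) - f (Inf k)) = f b - f a"
    proof -
      have "(\<Sum>k\<in>q \<union> c. f (Sup k) - f (Inf k)) =
            (\<Sum>k\<in>q. f (Sup k) - f (Inf k)) + (\<Sum>k\<in>c. f (Sup k) - f (Inf k))"
        by (rule sum.union_inter_neutral) (use fin zero in auto)
      with total[OF qc] show ?thesis by simp
    qed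
    ultimately show ?thesis by (metis add_right_cancel)
  qed
qed

lemma sum_lengths_division:
  fixes D :: "real set set"
  assumes "D division_of S"
  shows "(\<Sum>k\<in>D. Sup k - Inf k) = measure lebesgue S"
proof -
  have "Sup k - Inf k = measure lebesgue k" if kD: "k \<in> D" for k
  proof -
    obtain u v where "k = cbox u v" "k \<noteq> {}"
      using division_ofD(3,4)[OF assms kD] by metis
    then show ?thesis by auto
  qed
  then show ?thesis using content_division[OF assms] by simp
qed

text \<open>Vitali's theorem yields a countable disjoint family covering \<open>E\<close> up to a
  null set; by continuity of the measure, finitely many members already miss less than
  \<open>e\<close>. A finite family is what the definition of absolute continuity can be applied
  to.\<close>

lemma finite_Vitali_intervals:
  fixes E U :: "real set"
  assumes E: "E \<in> lmeasurable" "E \<subseteq> U" and U: "open U" and e: "0 < e"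
    and fine: "\<And>x d. x \<in> E \<Longrightarrow> 0 < d \<Longrightarrow> \<exists>u v. u < v \<and> x \<in> {u..v} \<and> v - u < d \<and> P u v"
  obtains D where "D division_of \<Union>D" "\<Union>D \<subseteq> U"
    "\<And>k. k \<in> D \<Longrightarrow> \<exists>u v. u < v \<and> k = {u..v} \<and> P u v"
    "measure lebesgue (E - \<Union>D) < e"
proof -
  define K where "K = {(u, v). u < v \<and> P u v \<and> {u..v} \<subseteq> U}"
  \<comment> \<open>Midpoints and half-lengths turn intervals, indexed by their endpoints, into the
    closed balls of the covering theorem.\<close>
  define c where "c = (\<lambda>(u::real, v). (u + v) / 2)"
  define r where "r = (\<lambda>(u::real, v). (v - u) / 2)"
  have cb: "cball (c i) (r i) = {fst i..snd i}" for i
    by (cases i) (auto simp: c_def r_def cball_eq_atLeastAtMost field_simps)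
  have fineK: "\<exists>i. i \<in> K \<and> x \<in> cball (c i) (r i) \<and> r i < d" if x: "x \<in> E" and d: "0 < d" for x d
  proof -
    obtain h where h: "0 < h" "ball x h \<subseteq> U" using U E x by (meson openE subsetD)
    obtain u v where uv: "u < v" "x \<in> {u..v}" "v - u < min d h" "P u v"
      using fine[OF x, of "min d h"] d h by auto
    then have "{u..v} \<subseteq> U" using h by (force simp: dist_real_def)
    then have "(u, v) \<in> K" using uv by (simp add: K_def)
    moreover have "r (u, v) < d" using uv by (simp add: r_def)
    ultimately show ?thesis using uv cb[of "(u, v)"] by (intro exI[of _ "(u, v)"]) auto
  qed
  have rpos: "\<And>i. i \<in> K \<Longrightarrow> 0 < r i" by (auto simp: K_def r_def)
  obtain C where C: "countable C" "C \<subseteq> K"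
     "pairwise (\<lambda>i j. disjnt (cball (c i) (r i)) (cball (c j) (r j))) C"
     "negligible (E - (\<Union>i\<in>C. cball (c i) (r i)))"
    using Vitali_covering_theorem_cballs[OF rpos fineK] by blast
  define I where "I = (\<lambda>i::real \<times> real. {fst i..snd i})"
  have C3: "pairwise (\<lambda>i j. disjnt (I i) (I j)) C" and C4: "negligible (E - (\<Union>i\<in>C. I i))"
    using C(3,4) unfolding cb I_def by auto
  have "\<exists>D'. finite D' \<and> D' \<subseteq> (\<lambda>i. E \<inter> I i) ` C \<and>
     measure lebesgue (\<Union>((\<lambda>i. E \<inter> I i) ` C)) - e < measure lebesgue (\<Union>D')"
  proof (rule measure_countable_Union_approachable[of "(\<lambda>i. E \<inter> I i) ` C" e "measure lebesgue E"])
    show "measure lebesgue (\<Union>D') \<le> measure lebesgue E"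
      if "D' \<subseteq> (\<lambda>i. E \<inter> I i) ` C" "finite D'" for D'
    proof (rule measure_mono_fmeasurable)
      show "\<Union>D' \<in> sets lebesgue"
      proof (rule sets.finite_Union)
        have "(\<lambda>i. E \<inter> I i) ` C \<subseteq> sets lebesgue"
          using E by (auto simp: I_def fmeasurableD)
        then show "D' \<subseteq> sets lebesgue" using that by blast
      qed (use that in blast)
    qed (use E that in auto)
  qed (use C e E in \<open>auto simp: I_def fmeasurable_Int_fmeasurable\<close>)
  then obtain D' where D': "finite D'" "D' \<subseteq> (\<lambda>i. E \<inter> I i) ` C"
    "measure lebesgue (\<Union>((\<lambda>i. E \<inter> I i) ` C)) - e < measure lebesgue (\<Union>D')" by blast
  moreover obtain C' where "C' \<subseteq> C" "finite C'" "D' = (\<lambda>i. E \<inter> I i) ` C'"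
    using finite_subset_image[OF D'(1,2)] by blast
  ultimately have C': "finite C'" "C' \<subseteq> C"
    "measure lebesgue (\<Union>((\<lambda>i. E \<inter> I i) ` C)) - e < measure lebesgue (\<Union>((\<lambda>i. E \<inter> I i) ` C'))"
    by auto
  define D where "D = I ` C'"
  have IK: "fst i < snd i \<and> I i \<subseteq> U \<and> P (fst i) (snd i)" if "i \<in> C'" for i
  proof -
    have "(fst i, snd i) \<in> K" using that C'(2) C(2) by auto
    then show ?thesis by (simp add: K_def I_def case_prod_unfold)
  qed
  show thesis
  proof
    show "D division_of \<Union>D"
    proof (rule division_ofI)
      fix k1 k2 assume k: "k1 \<in> D" "k2 \<in> D" "k1 \<noteq> k2"
      then obtain i j where ij: "i \<in> C'" "j \<in> C'" "k1 = I i" "k2 = I j" by (auto simp: D_def)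
      then have "i \<noteq> j" using k(3) by blast
      then have "disjnt k1 k2" using pairwiseD[OF C3, of i j] ij C'(2) by auto
      then show "interior k1 \<inter> interior k2 = {}"
        using interior_subset unfolding disjnt_def by blast
    next
      fix k assume "k \<in> D"
      then obtain i where i: "i \<in> C'" "k = I i" by (auto simp: D_def)
      show "k \<noteq> {}" using IK[OF i(1)] i(2) by (simp add: I_def)
      show "\<exists>a b. k = cbox a b" using i(2) by (auto simp: I_def)
    qed (use C' in \<open>auto simp: D_def\<close>)
    show "\<Union>D \<subseteq> U" using IK by (auto simp: D_def)
    show "\<exists>u v. u < v \<and> k = {u..v} \<and> P u v" if "k \<in> D" for k
      using that IK by (auto simp: D_def I_def)
    have meas: "E \<inter> \<Union>D \<in> lmeasurable"
      using C' by (intro fmeasurable_Int_fmeasurable E) (auto simp: D_def I_def intro!: sets.finite_Union)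
    have "E \<inter> (\<Union>i\<in>C. I i) \<in> sets lebesgue"
      using C E by (intro sets.Int sets.countable_UN') (auto simp: I_def fmeasurableD)
    then have "measure lebesgue (E - E \<inter> (\<Union>i\<in>C. I i)) = measure lebesgue E - measure lebesgue (E \<inter> (\<Union>i\<in>C. I i))"
      by (intro measurable_measure_Diff) (use E in auto)
    moreover have "measure lebesgue (E - E \<inter> (\<Union>i\<in>C. I i)) = 0"
      using negligible_imp_measure0[OF C4] by (simp add: Diff_Int)
    ultimately have m: "measure lebesgue (E \<inter> (\<Union>i\<in>C. I i)) = measure lebesgue E" by simp
    have "measure lebesgue (E - \<Union>D) = measure lebesgue (E - (E \<inter> \<Union>D))"
      by (simp add: Diff_Int)
    also have "\<dots> = measure lebesgue E - measure lebesgue (E \<inter> \<Union>D)"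
      by (rule measurable_measure_Diff) (use E meas in \<open>auto simp: fmeasurableD\<close>)
    also have "\<dots> < e" using C'(3) m by (simp add: D_def flip: Int_UN_distrib)
    finally show "measure lebesgue (E - \<Union>D) < e" .
  qed
qed

section \<open>Elementary properties of absolute continuity\<close>

lemma absolutely_continuous_onE:
  assumes "absolutely_continuous_on S f" "0 < \<epsilon>"
  obtains \<delta> where "0 < \<delta>"
    "\<And>D. D division_of \<Union>D \<Longrightarrow> \<Union>D \<subseteq> S \<Longrightarrow> (\<Sum>k\<in>D. Sup k - Inf k) < \<delta> \<Longrightarrow>
       (\<Sum>k\<in>D. norm (f (Sup k) - f (Inf k))) < \<epsilon>"
  using assms unfolding absolutely_continuous_on_def by blast

lemma absolutely_continuous_on_imp_continuous_on:
  assumes f: "absolutely_continuous_on {a..b} f"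
  shows "continuous_on {a..b} f"
  unfolding continuous_on_iff
proof (intro ballI allI impI)
  fix x e :: real assume x: "x \<in> {a..b}" and e: "0 < e"
  from f e obtain d where d: "0 < d"
    "\<And>D. D division_of \<Union>D \<Longrightarrow> \<Union>D \<subseteq> {a..b} \<Longrightarrow> (\<Sum>k\<in>D. Sup k - Inf k) < d \<Longrightarrow>
       (\<Sum>k\<in>D. norm (f (Sup k) - f (Inf k))) < e"
    by (rule absolutely_continuous_onE) blast
  have "norm (f v - f u) < e" if "u \<in> {a..b}" "v \<in> {a..b}" "u \<le> v" "v - u < d" for u v
    using d(2)[of "{cbox u v}"] division_of_self[of u v] that by auto
  then have "\<forall>y\<in>{a..b}. dist y x < d \<longrightarrow> dist (f y) (f x) < e"
    using x by (smt (verit, best) dist_norm norm_minus_commute real_norm_def)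
  with d(1) show "\<exists>d>0. \<forall>y\<in>{a..b}. dist y x < d \<longrightarrow> dist (f y) (f x) < e" by blast
qed

lemma absolutely_continuous_on_bounded_linear:
  assumes "bounded_linear h" and f: "absolutely_continuous_on S f"
  shows "absolutely_continuous_on S (\<lambda>x. h (f x))"
  unfolding absolutely_continuous_on_def
proof (intro allI impI)
  fix e :: real assume e: "0 < e"
  obtain K where K: "0 < K" "\<And>x. norm (h x) \<le> norm x * K"
    using bounded_linear.pos_bounded[OF assms(1)] by blast
  from f have "0 < e / K" using e K by simp
  with f obtain d where d: "0 < d"
    "\<And>D. D division_of \<Union>D \<Longrightarrow> \<Union>D \<subseteq> S \<Longrightarrow> (\<Sum>k\<in>D. Sup k - Inf k) < d \<Longrightarrow>
       (\<Sum>k\<in>D. norm (f (Sup k) - f (Inf k))) < e / K"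
    by (rule absolutely_continuous_onE) blast
  show "\<exists>\<delta>>0. \<forall>D. D division_of \<Union>D \<longrightarrow> \<Union>D \<subseteq> S \<longrightarrow> (\<Sum>k\<in>D. Sup k - Inf k) < \<delta> \<longrightarrow>
            (\<Sum>k\<in>D. norm (h (f (Sup k)) - h (f (Inf k)))) < e"
  proof (intro exI[of _ d] conjI allI impI d(1))
    fix D assume D: "D division_of \<Union>D" "\<Union>D \<subseteq> S" "(\<Sum>k\<in>D. Sup k - Inf k) < d"
    have "(\<Sum>k\<in>D. norm (h (f (Sup k)) - h (f (Inf k)))) \<le> (\<Sum>k\<in>D. norm (f (Sup k) - f (Inf k)) * K)"
      using K(2) by (intro sum_mono) (simp flip: linear_diff[OF bounded_linear.linear[OF assms(1)]])
    also have "\<dots> = (\<Sum>k\<in>D. norm (f (Sup k) - f (Inf k))) * K" by (simp add: sum_distrib_right)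
    also have "\<dots> < e" using d(2)[OF D] K(1) by (simp add: pos_less_divide_eq)
    finally show "(\<Sum>k\<in>D. norm (h (f (Sup k)) - h (f (Inf k)))) < e" .
  qed
qed

lemma lipschitz_imp_absolutely_continuous_on:
  assumes "L-lipschitz_on S f"
  shows "absolutely_continuous_on S f"
  unfolding absolutely_continuous_on_def
proof (intro allI impI)
  fix e :: real assume e: "0 < e"
  have L: "0 \<le> L" using assms by (rule lipschitz_on_nonneg)
  show "\<exists>\<delta>>0. \<forall>D. D division_of \<Union>D \<longrightarrow> \<Union>D \<subseteq> S \<longrightarrow> (\<Sum>k\<in>D. Sup k - Inf k) < \<delta> \<longrightarrow>
            (\<Sum>k\<in>D. norm (f (Sup k) - f (Inf k))) < e"
  \<comment> \<open>The summand 1 keeps the quotient meaningful for \<open>L = 0\<close>.\<close>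
  proof (intro exI[of _ "e / (L + 1)"] conjI allI impI)
    fix D assume D: "D division_of \<Union>D" "\<Union>D \<subseteq> S" "(\<Sum>k\<in>D. Sup k - Inf k) < e / (L + 1)"
    have le: "norm (f (Sup k) - f (Inf k)) \<le> (L + 1) * (Sup k - Inf k)" if kD: "k \<in> D" for k
    proof -
      obtain u v where k: "k = cbox u v" "k \<noteq> {}" using division_ofD(3,4)[OF D(1) kD] by metis
      then have "u \<le> v" by auto
      have "k \<subseteq> S" using kD D(2) by blast
      then have "u \<in> S" "v \<in> S" using k(1) \<open>u \<le> v\<close> by auto
      then have "norm (f v - f u) \<le> L * (v - u)"
        using lipschitz_onD[OF assms, of v u] \<open>u \<le> v\<close> by (simp add: dist_norm)
      then show ?thesis using k \<open>u \<le> v\<close> by (simp add: algebra_simps)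
    qed
    have "(\<Sum>k\<in>D. norm (f (Sup k) - f (Inf k))) \<le> (\<Sum>k\<in>D. (L + 1) * (Sup k - Inf k))"
      using le by (rule sum_mono)
    also have "\<dots> = (L + 1) * (\<Sum>k\<in>D. Sup k - Inf k)" by (simp add: sum_distrib_left)
    also have "\<dots> < e" using D(3) L by (simp add: pos_less_divide_eq mult.commute)
    finally show "(\<Sum>k\<in>D. norm (f (Sup k) - f (Inf k))) < e" .
  qed (use e L in simp)
qed

section \<open>Differentiability almost everywhere\<close>

text \<open>Standard Vitali arguments for differentiability compare increments of monotone functions. Here
  absolute continuity replaces monotonicity: it makes the increment over a set of small measure
  small, so two families of intervals that cover almost the same set have almost the same total
  increment, whatever the slopes.\<close>

definition steep_points :: "(real \<Rightarrow> real) \<Rightarrow> real \<Rightarrow> real \<Rightarrow> real \<Rightarrow> real set" where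
  "steep_points f a b \<beta> = {x\<in>{a<..<b}. \<exists>\<^sub>F y in at x within {a<..<b}. \<beta> < (f y - f x) / (y - x)}"

text \<open>The set is a countable intersection of open sets: being frequently steep near
  \<open>x\<close> means that for every \<open>n\<close> some \<open>y\<close> within
  \<open>1 / Suc n\<close> of \<open>x\<close> is steep, and for fixed \<open>n\<close> and
  \<open>y\<close> these \<open>x\<close> form the open set \<open>V n y\<close>.\<close>

lemma steep_points_measurable:
  assumes f: "continuous_on {a<..<b} f"
  shows "steep_points f a b \<beta> \<in> lmeasurable"
proof -
  define V where "V = (\<lambda>n y. {x\<in>{a<..<b} - {y}. \<bar>y - x\<bar> < 1 / Suc n \<and> \<beta> < (f y - f x) / (y - x)})"
  have "open (V n y)" for n y
  proof -
    have "V n y = {x. \<bar>y - x\<bar> < 1 / Suc n} \<inter>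
        ((\<lambda>x. (f y - f x) / (y - x)) -` {\<beta><..} \<inter> ({a<..<b} - {y}))"
      by (auto simp: V_def)
    moreover have "continuous_on ({a<..<b} - {y}) (\<lambda>x. (f y - f x) / (y - x))"
      by (intro continuous_intros continuous_on_subset[OF f]) auto
    then have "open ((\<lambda>x. (f y - f x) / (y - x)) -` {\<beta><..} \<inter> ({a<..<b} - {y}))"
      using continuous_on_open_vimage[of "{a<..<b} - {y}" "\<lambda>x. (f y - f x) / (y - x)"] by (simp add: open_delete)
    moreover have "open {x. \<bar>y - x\<bar> < 1 / Suc n}"
      by (intro open_Collect_less continuous_intros)
    ultimately show ?thesis by (simp only: open_Int)
  qed
  then have "open (\<Union>y\<in>{a<..<b}. V n y)" for n by blast
  then have "(\<Inter>n. \<Union>y\<in>{a<..<b}. V n y) \<in> sets lebesgue"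
    by (intro sets.countable_INT') auto
  moreover have "steep_points f a b \<beta> = (\<Inter>n. \<Union>y\<in>{a<..<b}. V n y)"
  proof (intro set_eqI iffI)
    fix x assume "x \<in> steep_points f a b \<beta>"
    then have x: "x \<in> {a<..<b}" and ev: "\<forall>e>0. \<exists>y\<in>{a<..<b}. y \<noteq> x \<and> dist y x < e \<and> \<beta> < (f y - f x) / (y - x)"
      by (auto simp: steep_points_def frequently_at)
    show "x \<in> (\<Inter>n. \<Union>y\<in>{a<..<b}. V n y)"
    proof
      fix n
      obtain y where "y \<in> {a<..<b}" "y \<noteq> x" "dist y x < 1 / Suc n" "\<beta> < (f y - f x) / (y - x)"
        using ev[rule_format, of "1 / Suc n"] by auto
      with x show "x \<in> (\<Union>y\<in>{a<..<b}. V n y)" by (auto simp: V_def dist_real_def)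
    qed
  next
    fix x assume x: "x \<in> (\<Inter>n. \<Union>y\<in>{a<..<b}. V n y)"
    have "\<exists>y\<in>{a<..<b}. y \<noteq> x \<and> dist y x < e \<and> \<beta> < (f y - f x) / (y - x)" if "0 < e" for e
    proof -
      obtain n where n: "1 / Suc n < e" using nat_approx_posE \<open>0 < e\<close> by blast
      from x obtain y where "y \<in> {a<..<b}" "x \<in> V n y" by blast
      with n show ?thesis by (intro bexI[of _ y]) (auto simp: V_def dist_real_def)
    qed
    moreover have "x \<in> {a<..<b}" using x by (auto simp: V_def)
    ultimately show "x \<in> steep_points f a b \<beta>" by (simp add: steep_points_def frequently_at)
  qed
  ultimately have "steep_points f a b \<beta> \<in> sets lebesgue" by simp
  moreover have "steep_points f a b \<beta> \<subseteq> {a..b}" by (auto simp: steep_points_def)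
  ultimately show ?thesis
    by (meson bounded_closed_interval bounded_set_imp_lmeasurable bounded_subset)
qed

text \<open>The difference quotient is symmetric in its two points, so \<open>x\<close> and a nearby
  \<open>y\<close> span a steep interval whichever of them is on the left. This is the fineness
  condition for the Vitali covering.\<close>

lemma steep_points_covered:
  assumes x: "x \<in> steep_points f a b \<beta>" and d: "0 < d"
  shows "\<exists>u v. u < v \<and> x \<in> {u..v} \<and> v - u < d \<and> \<beta> * (v - u) < f v - f u"
proof -
  obtain y where y: "y \<noteq> x" "dist y x < d" "\<beta> < (f y - f x) / (y - x)"
    using x d by (auto simp: steep_points_def frequently_at)
  show ?thesis
  proof (cases "x < y")
    case True
    then show ?thesis using y
      by (intro exI[of _ x] exI[of _ y]) (auto simp: dist_real_def field_simps)
  next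
    case False
    then show ?thesis using y
      by (intro exI[of _ y] exI[of _ x]) (auto simp: dist_real_def field_simps)
  qed
qed


text \<open>If the set \<open>E\<close> had measure \<open>m > 0\<close>, one could cover most of it
  by intervals \<open>I\<close> of slope at most \<alpha>, and most of their length by intervals
  \<open>J\<close> inside them of slope at least \<beta>. The leftover has small length, hence a
  small increment, so the increments over \<open>I\<close> and \<open>J\<close> nearly agree, which
  contradicts \<alpha> < \<beta>.\<close>

lemma steep_up_down_negligible:
  fixes f :: "real \<Rightarrow> real"
  assumes f: "absolutely_continuous_on {a..b} f" and ab: "\<alpha> < \<beta>"
  shows "negligible (steep_points f a b \<beta> \<inter> steep_points (\<lambda>x. - f x) a b (- \<alpha>))"
proof (rule ccontr)
  define E where "E = steep_points f a b \<beta> \<inter> steep_points (\<lambda>x. - f x) a b (- \<alpha>)"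
  define m where "m = measure lebesgue E"
  assume "\<not> negligible (steep_points f a b \<beta> \<inter> steep_points (\<lambda>x. - f x) a b (- \<alpha>))"
  then have "\<not> negligible E" by (simp add: E_def)
  have cont: "continuous_on {a<..<b} f"
    using absolutely_continuous_on_imp_continuous_on[OF f] by (rule continuous_on_subset) auto
  have E: "E \<in> lmeasurable"
    unfolding E_def by (intro fmeasurable.Int steep_points_measurable continuous_intros cont)
  with \<open>\<not> negligible E\<close> have m: "0 < m"
    unfolding m_def by (metis negligible_iff_measure zero_less_measure_iff)
  have Eab: "E \<subseteq> {a<..<b}" by (auto simp: E_def steep_points_def)
  have pos: "0 < (\<beta> - \<alpha>) * m / 4" using ab m by simp
  from f this obtain \<delta> where \<delta>: "0 < \<delta>"
    "\<And>D. D division_of \<Union>D \<Longrightarrow> \<Union>D \<subseteq> {a..b} \<Longrightarrow> (\<Sum>k\<in>D. Sup k - Inf k) < \<delta> \<Longrightarrow>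
       (\<Sum>k\<in>D. norm (f (Sup k) - f (Inf k))) < (\<beta> - \<alpha>) * m / 4"
    by (rule absolutely_continuous_onE) blast
  \<comment> \<open>The three bounds give, in turn, \<open>m - e \<ge> 3 * m / 4\<close>, an error
    of at most \<open>(\<beta> - \<alpha>) * m / 4\<close> when \<beta> multiplies a length up to
    \<open>2 * e\<close>, and \<open>2 * e < \<delta>\<close>.\<close>
  define e where "e = min (m / 4) (min ((\<beta> - \<alpha>) * m / (8 * (\<bar>\<beta>\<bar> + 1))) (\<delta> / 4))"
  have e: "0 < e" "e \<le> m / 4" "e \<le> \<delta> / 4" using m ab \<delta>(1) unfolding e_def by (simp, linarith, linarith)
  have e\<beta>: "e * \<bar>\<beta>\<bar> \<le> (\<beta> - \<alpha>) * m / 8"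
  proof -
    have "e * (\<bar>\<beta>\<bar> + 1) \<le> (\<beta> - \<alpha>) * m / (8 * (\<bar>\<beta>\<bar> + 1)) * (\<bar>\<beta>\<bar> + 1)"
      by (intro mult_right_mono) (auto simp: e_def)
    also have "\<dots> = (\<beta> - \<alpha>) * m / 8" by (simp add: field_simps add_nonneg_eq_0_iff)
    finally show ?thesis using e(1) by (simp add: algebra_simps)
  qed
  \<comment> \<open>Confining the intervals to an open set that exceeds \<open>E\<close> by less
    than \<open>e\<close> keeps \<open>I\<close> from being much longer than
    \<open>E\<close>.\<close>
  obtain U0 where U0: "open U0" "E \<subseteq> U0" "U0 - E \<in> lmeasurable" "emeasure lebesgue (U0 - E) < ennreal e"
    using sets_lebesgue_outer_open[OF fmeasurableD[OF E] e(1)] by blast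
  define U where "U = U0 \<inter> {a<..<b}"
  have U: "open U" "E \<subseteq> U" "U \<subseteq> {a<..<b}" using U0 Eab by (auto simp: U_def)
  have UE: "U - E \<in> lmeasurable"
    using E U by (intro bounded_set_imp_lmeasurable bounded_subset[OF bounded_closed_interval[of a b]])
      (auto simp: fmeasurableD)
  have mUE: "measure lebesgue (U - E) < e"
  proof -
    have "measure lebesgue (U - E) \<le> measure lebesgue (U0 - E)"
      by (rule measure_mono_fmeasurable) (use U0 UE in \<open>auto simp: U_def fmeasurableD\<close>)
    also have "\<dots> < e" using U0(3,4) e(1) by (simp add: emeasure_eq_measure2 ennreal_less_iff)
    finally show ?thesis .
  qed
  obtain I where I: "I division_of \<Union>I" "\<Union>I \<subseteq> U"
    "\<And>k. k \<in> I \<Longrightarrow> \<exists>u v. u < v \<and> k = {u..v} \<and> f v - f u \<le> \<alpha> * (v - u)"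
    "measure lebesgue (E - \<Union>I) < e"
  proof (rule finite_Vitali_intervals[OF E U(2,1) e(1), of "\<lambda>u v. f v - f u \<le> \<alpha> * (v - u)"])
    fix x d :: real assume "x \<in> E" "0 < d"
    then obtain u v where "u < v \<and> x \<in> {u..v} \<and> v - u < d \<and> - \<alpha> * (v - u) < - f v - - f u"
      using steep_points_covered[of x "\<lambda>x. - f x" a b "- \<alpha>" d] by (auto simp: E_def)
    then show "\<exists>u v. u < v \<and> x \<in> {u..v} \<and> v - u < d \<and> f v - f u \<le> \<alpha> * (v - u)"
      by (intro exI[of _ u] exI[of _ v]) auto
  qed blast
  \<comment> \<open>The second covering needs an open set around the points; passing to the interior
    loses only finitely many endpoints.\<close>
  define W where "W = interior (\<Union>I)"
  have fineJ: "\<exists>u v. u < v \<and> x \<in> {u..v} \<and> v - u < d \<and> \<beta> * (v - u) \<le> f v - f u"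
    if xE: "x \<in> E \<inter> W" and d: "0 < d" for x d
  proof -
    have "x \<in> steep_points f a b \<beta>" using xE by (simp add: E_def)
    from steep_points_covered[OF this d] show ?thesis by (meson less_imp_le)
  qed
  have EW: "E \<inter> W \<in> lmeasurable" "E \<inter> W \<subseteq> W" "open W"
    using E by (intro fmeasurable_Int_fmeasurable) (auto simp: W_def)
  obtain J where J: "J division_of \<Union>J" "\<Union>J \<subseteq> W"
    "\<And>k. k \<in> J \<Longrightarrow> \<exists>u v. u < v \<and> k = {u..v} \<and> \<beta> * (v - u) \<le> f v - f u"
    "measure lebesgue (E \<inter> W - \<Union>J) < e"
    using finite_Vitali_intervals[OF EW e(1) fineJ] by blast
  have JI: "\<Union>J \<subseteq> \<Union>I" using J(2) interior_subset unfolding W_def by blast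
  \<comment> \<open>Completing \<open>J\<close> to a division of \<open>\<Union>I\<close> isolates
    the leftover \<open>r - J\<close>, whose total length will be at most
    \<open>2 * e\<close>.\<close>
  obtain r where r: "J \<subseteq> r" "r division_of \<Union>I"
    using partial_division_extend[OF J(1) I(1) JI] by blast
  have rdiv: "r - J division_of \<Union>(r - J)"
    using division_of_subset[of r "r - J"] r division_ofD(6)[OF r(2)] by simp
  have fin: "finite r" using r by blast
  let ?len = "\<lambda>D. \<Sum>k\<in>D. Sup k - Inf k :: real"
  have split: "(\<Sum>k\<in>I. h (Sup k) - h (Inf k)) =
      (\<Sum>k\<in>J. h (Sup k) - h (Inf k)) + (\<Sum>k\<in>r - J. h (Sup k) - h (Inf k))" for h :: "real \<Rightarrow> real"
    using sum_increments_division_unique[OF I(1) r(2), of h]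
      sum.subset_diff[OF r(1) fin, of "\<lambda>k. h (Sup k) - h (Inf k)"] by simp
  have mI: "\<Union>I \<in> lmeasurable" and mJ: "\<Union>J \<in> lmeasurable"
    using I(1) J(1) by (auto intro: lmeasurable_division)
  have len_ge: "m - e \<le> ?len I"
  proof -
    have "m \<le> measure lebesgue (E - \<Union>I) + measure lebesgue (\<Union>I)"
      unfolding m_def using E mI
      by (intro order_trans[OF measure_mono_fmeasurable measure_Un_le])
         (auto simp: fmeasurableD fmeasurable.Un fmeasurable_Diff)
    then show ?thesis using I(4) sum_lengths_division[OF I(1)] by simp
  qed
  have len_le: "?len I \<le> ?len J + 2 * e"
  proof -
    have "negligible (\<Union>I - W)"
    proof (rule negligible_subset)
      have "negligible (k - interior k)" if "k \<in> I" for k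
      proof -
        obtain u v where "k = {u..v}" using I(3) \<open>k \<in> I\<close> by blast
        then have "k - interior k \<subseteq> {u, v}" by auto
        then show ?thesis by (rule negligible_subset[rotated]) (simp add: negligible_finite)
      qed
      then show "negligible (\<Union>k\<in>I. k - interior k)"
        using I(1) by (intro negligible_Union) auto
      show "\<Union>I - W \<subseteq> (\<Union>k\<in>I. k - interior k)"
        unfolding W_def using interior_mono[of _ "\<Union>I"] by blast
    qed
    then have z: "measure lebesgue (\<Union>I - W) = 0" "\<Union>I - W \<in> lmeasurable"
      by (auto simp: negligible_imp_measure0 negligible_imp_measurable)
    \<comment> \<open>A point of \<open>\<Union>I\<close> lies outside \<open>E\<close>, or in
      \<open>E \<inter> W\<close> but missed by \<open>J\<close>, or outside \<open>W\<close>, or in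
      \<open>\<Union>J\<close>. The first two sets have measure below \<open>e\<close> and the third
      is null.\<close>
    let ?A = "U - E" and ?B = "E \<inter> W - \<Union>J"
    have AB: "?A \<in> lmeasurable" "?B \<in> lmeasurable"
      using UE E mJ EW(1) by (auto intro: fmeasurable_Diff simp: fmeasurableD)
    have "measure lebesgue (\<Union>I) \<le> measure lebesgue (((?A \<union> ?B) \<union> (\<Union>I - W)) \<union> \<Union>J)"
      using I(2) AB z mI mJ by (intro measure_mono_fmeasurable) (auto simp: fmeasurableD)
    also have "\<dots> \<le> measure lebesgue ((?A \<union> ?B) \<union> (\<Union>I - W)) + measure lebesgue (\<Union>J)"
      using AB z mJ by (intro measure_Un_le) (auto simp: fmeasurableD)
    also have "\<dots> \<le> measure lebesgue (?A \<union> ?B) + measure lebesgue (\<Union>I - W) + measure lebesgue (\<Union>J)"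
      using AB z mJ by (intro add_right_mono measure_Un_le) (auto simp: fmeasurableD)
    also have "\<dots> \<le> measure lebesgue ?A + measure lebesgue ?B + measure lebesgue (\<Union>I - W) + measure lebesgue (\<Union>J)"
      using AB z mJ by (intro add_right_mono measure_Un_le) (auto simp: fmeasurableD)
    finally show ?thesis
      using mUE J(4) z sum_lengths_division[OF I(1)] sum_lengths_division[OF J(1)] by simp
  qed
  have gap: "\<bar>\<Sum>k\<in>r - J. f (Sup k) - f (Inf k)\<bar> < (\<beta> - \<alpha>) * m / 4"
  proof -
    have "(\<Sum>k\<in>r - J. Sup k - Inf k) < \<delta>"
      using split[of "\<lambda>x. x"] len_le e(1,3) \<delta>(1) by linarith
    moreover have "\<Union>(r - J) \<subseteq> {a<..<b}"
      using division_ofD(6)[OF r(2)] I(2) U(3) by blast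
    then have "\<Union>(r - J) \<subseteq> {a..b}"
      by (rule order_trans) auto
    ultimately have "(\<Sum>k\<in>r - J. norm (f (Sup k) - f (Inf k))) < (\<beta> - \<alpha>) * m / 4"
      using \<delta>(2)[OF rdiv] by blast
    then show ?thesis
      using sum_abs[of "\<lambda>k. f (Sup k) - f (Inf k)" "r - J"] unfolding real_norm_def by linarith
  qed
  have up: "\<beta> * ?len J \<le> (\<Sum>k\<in>J. f (Sup k) - f (Inf k))"
    unfolding sum_distrib_left using J(3) by (intro sum_mono) fastforce
  have down: "(\<Sum>k\<in>I. f (Sup k) - f (Inf k)) \<le> \<alpha> * ?len I"
    unfolding sum_distrib_left using I(3) by (intro sum_mono) fastforce
  have len_mono: "?len J \<le> ?len I"
    using sum_lengths_division[OF I(1)] sum_lengths_division[OF J(1)] mI mJ JI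
    by (simp add: measure_mono_fmeasurable fmeasurableD)
  \<comment> \<open>The sign of \<beta> is unknown, hence the absolute value.\<close>
  have "\<beta> * (?len I - ?len J) \<le> \<bar>\<beta>\<bar> * (2 * e)"
    using len_le len_mono by (intro order_trans[OF mult_right_mono[of \<beta> "\<bar>\<beta>\<bar>"]] mult_left_mono) auto
  also have "\<dots> \<le> (\<beta> - \<alpha>) * m / 4" using e\<beta> by (simp add: algebra_simps)
  finally have "(\<beta> - \<alpha>) * ?len I < (\<beta> - \<alpha>) * m / 4 + (\<beta> - \<alpha>) * m / 4"
    using up down gap split[of f] by (simp add: algebra_simps)
  also have "\<dots> = (\<beta> - \<alpha>) * (m / 2)" by (simp add: algebra_simps)
  finally have "?len I < m / 2" using ab by (simp add: mult_less_cancel_left_pos)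
  with len_ge e(2) m show False by simp
qed

text \<open>Inside a ball shorter than \<delta>, positive measure \<open>m\<close> would yield
  nonoverlapping intervals of slope at least \<open>n\<close> and total length between
  \<open>m / 2\<close> and \<delta>. For \<open>n > 2 / m\<close> their increments add up to more
  than 1, against absolute continuity with tolerance 1.\<close>

lemma infinitely_steep_negligible:
  fixes f :: "real \<Rightarrow> real"
  assumes f: "absolutely_continuous_on {a..b} f"
  shows "negligible (\<Inter>n::nat. steep_points f a b n)"
proof -
  define E where "E = (\<Inter>n::nat. steep_points f a b n)"
  have cont: "continuous_on {a<..<b} f"
    using absolutely_continuous_on_imp_continuous_on[OF f] by (rule continuous_on_subset) auto
  have Es: "E \<in> sets lebesgue"
    unfolding E_def using steep_points_measurable[OF cont] by (intro sets.countable_INT') (auto simp: fmeasurableD)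
  obtain \<delta> where \<delta>: "0 < \<delta>"
    "\<And>D. D division_of \<Union>D \<Longrightarrow> \<Union>D \<subseteq> {a..b} \<Longrightarrow> (\<Sum>k\<in>D. Sup k - Inf k) < \<delta> \<Longrightarrow>
       (\<Sum>k\<in>D. norm (f (Sup k) - f (Inf k))) < 1"
    using f by (rule absolutely_continuous_onE[of _ _ 1]) auto
  \<comment> \<open>This ball has length \<open>\<delta> / 2\<close>, safely below \<delta>;
    negligibility is then patched together from local pieces.\<close>
  have "negligible (E \<inter> ball x (\<delta> / 4))" for x
  proof (rule ccontr)
    define A where "A = E \<inter> ball x (\<delta> / 4)"
    define m where "m = measure lebesgue A"
    assume "\<not> negligible (E \<inter> ball x (\<delta> / 4))"
    then have "\<not> negligible A" by (simp add: A_def)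
    have A: "A \<in> lmeasurable"
      unfolding A_def using Es by (intro bounded_set_imp_lmeasurable) auto
    with \<open>\<not> negligible A\<close> have m: "0 < m"
      unfolding m_def by (metis negligible_iff_measure zero_less_measure_iff)
    have Aab: "A \<subseteq> {a<..<b}" by (auto simp: A_def E_def steep_points_def)
    obtain n :: nat where n: "2 / m < n" using reals_Archimedean2 by blast
    define U where "U = ball x (\<delta> / 4) \<inter> {a<..<b}"
    have fine: "\<exists>u v. u < v \<and> z \<in> {u..v} \<and> v - u < d \<and> real n * (v - u) \<le> f v - f u"
      if z: "z \<in> A" and d: "0 < d" for z d :: real
    proof -
      have "z \<in> steep_points f a b n" using z by (simp add: A_def E_def)
      from steep_points_covered[OF this d] show ?thesis by (meson less_imp_le)
    qed
    have AU: "A \<subseteq> U" "open U" "0 < m / 2" using Aab m by (auto simp: U_def A_def)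
    obtain D where D: "D division_of \<Union>D" "\<Union>D \<subseteq> U"
      "\<And>k. k \<in> D \<Longrightarrow> \<exists>u v. u < v \<and> k = {u..v} \<and> real n * (v - u) \<le> f v - f u"
      "measure lebesgue (A - \<Union>D) < m / 2"
      using finite_Vitali_intervals[OF A AU fine] by blast
    have mD: "\<Union>D \<in> lmeasurable" using D(1) by (auto intro: lmeasurable_division)
    have "m \<le> measure lebesgue (A - \<Union>D) + measure lebesgue (\<Union>D)"
      unfolding m_def using A mD
      by (intro order_trans[OF measure_mono_fmeasurable measure_Un_le])
         (auto simp: fmeasurableD fmeasurable.Un fmeasurable_Diff)
    then have lo: "m / 2 < (\<Sum>k\<in>D. Sup k - Inf k)" using D(4) sum_lengths_division[OF D(1)] by simp
    have "measure lebesgue (\<Union>D) \<le> measure lebesgue (ball x (\<delta> / 4))"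
      using D(2) mD by (intro measure_mono_fmeasurable) (auto simp: U_def fmeasurableD)
    also have "\<dots> < \<delta>" using \<delta>(1) by (simp add: ball_eq_greaterThanLessThan)
    finally have "(\<Sum>k\<in>D. Sup k - Inf k) < \<delta>" using sum_lengths_division[OF D(1)] by simp
    moreover have "\<Union>D \<subseteq> {a..b}" using D(2) by (force simp: U_def)
    ultimately have "(\<Sum>k\<in>D. norm (f (Sup k) - f (Inf k))) < 1" using \<delta>(2) D(1) by blast
    then have "(\<Sum>k\<in>D. f (Sup k) - f (Inf k)) < 1"
      using sum_abs[of "\<lambda>k. f (Sup k) - f (Inf k)" D] unfolding real_norm_def by linarith
    moreover have "real n * (\<Sum>k\<in>D. Sup k - Inf k) \<le> (\<Sum>k\<in>D. f (Sup k) - f (Inf k))"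
      unfolding sum_distrib_left using D(3) by (intro sum_mono) fastforce
    moreover have "1 < real n * (m / 2)" using n m by (simp add: field_simps)
    moreover have "real n * (m / 2) \<le> real n * (\<Sum>k\<in>D. Sup k - Inf k)" using lo by (intro mult_left_mono) auto
    ultimately show False by linarith
  qed
  then have "negligible E"
    unfolding locally_negligible_alt[of E] using \<delta>(1)
    by (metis Int_iff centre_in_ball divide_pos_pos openin_open_Int open_ball zero_less_numeral)
  then show ?thesis by (simp add: E_def)
qed

text \<open>Without infinite steepness in either direction the difference quotient is bounded near
  \<open>x\<close>, so its upper limit is finite. Without oscillation across a rational gap, the
  lower limit cannot fall below it.\<close>

lemma differentiable_off_steep_points:
  fixes f :: "real \<Rightarrow> real"
  assumes x: "x \<in> {a<..<b}"
    and osc: "\<And>\<alpha> \<beta>. \<alpha> \<in> \<rat> \<Longrightarrow> \<beta> \<in> \<rat> \<Longrightarrow> \<alpha> < \<beta> \<Longrightarrow>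
      x \<notin> steep_points f a b \<beta> \<inter> steep_points (\<lambda>x. - f x) a b (- \<alpha>)"
    and up: "x \<notin> (\<Inter>n::nat. steep_points f a b n)"
    and down: "x \<notin> (\<Inter>n::nat. steep_points (\<lambda>x. - f x) a b n)"
  shows "\<exists>D. (f has_real_derivative D) (at x)"
proof -
  define q where "q y = (f y - f x) / (y - x)" for y
  have at: "at x within {a<..<b} = at x" using x by (intro at_within_open) auto
  have steep: "x \<in> steep_points f a b \<beta> \<longleftrightarrow> \<not> (\<forall>\<^sub>F y in at x. q y \<le> \<beta>)" for \<beta>
    using x by (simp add: steep_points_def at q_def frequently_def not_less del: greaterThanLessThan_iff)
  have "(- f y - - f x) / (y - x) = - q y" for y
    unfolding q_def by (simp add: diff_divide_distrib)
  then have steep_neg: "x \<in> steep_points (\<lambda>x. - f x) a b \<beta> \<longleftrightarrow> \<not> (\<forall>\<^sub>F y in at x. - \<beta> \<le> q y)" for \<beta>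
    using x by (simp add: steep_points_def at frequently_def not_less minus_le_iff del: greaterThanLessThan_iff)
  obtain B1 where B1: "\<forall>\<^sub>F y in at x. q y \<le> B1" using up steep by blast
  obtain B2 where B2: "\<forall>\<^sub>F y in at x. B2 \<le> q y" using down steep_neg by blast
  \<comment> \<open>The infimum of the eventual upper bounds of \<open>q\<close> is its upper limit
    at \<open>x\<close>.\<close>
  define A where "A = {\<beta>. \<forall>\<^sub>F y in at x. q y \<le> \<beta>}"
  define D where "D = Inf A"
  have "B1 \<in> A" using B1 by (simp add: A_def)
  have "B2 \<le> \<beta>" if "\<beta> \<in> A" for \<beta>
  proof -
    have "\<forall>\<^sub>F y in at x. q y \<le> \<beta>" using that by (simp add: A_def)
    with B2 have "\<forall>\<^sub>F y in at x. B2 \<le> \<beta>" by eventually_elim simp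
    then show ?thesis by simp
  qed
  then have bdd: "bdd_below A" by (rule bdd_belowI)
  have "(q \<longlongrightarrow> D) (at x)"
  proof (rule order_tendstoI)
    fix c assume "D < c"
    then obtain \<beta> where "\<beta> \<in> A" "\<beta> < c"
      using \<open>B1 \<in> A\<close> cInf_lessD[of A c] by (auto simp: D_def)
    then show "\<forall>\<^sub>F y in at x. q y < c" by (auto simp: A_def elim: eventually_mono)
  next
    fix c assume "c < D"
    \<comment> \<open>Since \<beta> lies below the upper limit, \<open>q\<close> frequently exceeds
      it; \<open>osc\<close> then keeps \<open>q\<close> eventually at or above \<alpha>, which is
      strictly above \<open>c\<close>.\<close>
    obtain \<beta> where \<beta>: "\<beta> \<in> \<rat>" "c < \<beta>" "\<beta> < D" using Rats_dense_in_real[OF \<open>c < D\<close>] by blast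
    obtain \<alpha> where \<alpha>: "\<alpha> \<in> \<rat>" "c < \<alpha>" "\<alpha> < \<beta>" using Rats_dense_in_real[OF \<beta>(2)] by blast
    have "\<beta> \<notin> A" using cInf_lower[OF _ bdd, of \<beta>] \<beta>(3) by (auto simp: D_def)
    then have "x \<in> steep_points f a b \<beta>" by (simp add: steep A_def)
    with osc[OF \<alpha>(1) \<beta>(1) \<alpha>(3)] have "\<forall>\<^sub>F y in at x. \<alpha> \<le> q y" by (simp add: steep_neg)
    then show "\<forall>\<^sub>F y in at x. c < q y" by eventually_elim (use \<alpha>(2) in simp)
  qed
  then show ?thesis unfolding has_field_derivative_iff q_def by blast
qed

lemma absolutely_continuous_on_differentiable_real:
  fixes f :: "real \<Rightarrow> real"
  assumes f: "absolutely_continuous_on {a..b} f"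
  shows "\<exists>N. negligible N \<and> (\<forall>x\<in>{a<..<b} - N. \<exists>D. (f has_real_derivative D) (at x))"
proof -
  have g: "absolutely_continuous_on {a..b} (\<lambda>x. - f x)"
    using absolutely_continuous_on_bounded_linear[OF bounded_linear_minus[OF bounded_linear_ident] f] .
  \<comment> \<open>Rational pairs keep the union of exceptional sets countable.\<close>
  define N where "N = (\<Union>(\<alpha>, \<beta>)\<in>{(\<alpha>, \<beta>) \<in> \<rat> \<times> \<rat>. \<alpha> < \<beta>}.
      steep_points f a b \<beta> \<inter> steep_points (\<lambda>x. - f x) a b (- \<alpha>)) \<union>
    (\<Inter>n::nat. steep_points f a b n) \<union> (\<Inter>n::nat. steep_points (\<lambda>x. - f x) a b n)"
  have "countable {(\<alpha>::real, \<beta>) \<in> \<rat> \<times> \<rat>. \<alpha> < \<beta>}"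
    by (rule countable_subset[of _ "\<rat> \<times> \<rat>"]) (auto simp: countable_rat)
  then have "negligible N"
    unfolding N_def using steep_up_down_negligible[OF f]
    by (intro negligible_Un infinitely_steep_negligible[OF f] infinitely_steep_negligible[OF g]
        negligible_countable_Union) (auto simp: image_iff)
  moreover have "\<exists>D. (f has_real_derivative D) (at x)" if "x \<in> {a<..<b} - N" for x
    using that by (intro differentiable_off_steep_points[of x a b f]) (auto simp: N_def)
  ultimately show ?thesis by blast
qed

lemma absolutely_continuous_on_differentiable:
  fixes f :: "real \<Rightarrow> 'a::euclidean_space"
  assumes f: "absolutely_continuous_on {a..b} f"
  shows "\<exists>N. negligible N \<and> (\<forall>x\<in>{a<..<b} - N. \<exists>D. (f has_vector_derivative D) (at x))"
proof -
  have "\<exists>N. negligible N \<and> (\<forall>x\<in>{a<..<b} - N. \<exists>D. ((\<lambda>s. f s \<bullet> i) has_real_derivative D) (at x))" for i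
    by (intro absolutely_continuous_on_differentiable_real
        absolutely_continuous_on_bounded_linear[OF bounded_linear_inner_left f])
  then obtain N where N: "\<And>i. negligible (N i)"
    "\<And>i x. x \<in> {a<..<b} - N i \<Longrightarrow> \<exists>D. ((\<lambda>s. f s \<bullet> i) has_real_derivative D) (at x)" by metis
  have "negligible (\<Union>(N ` Basis))" using N(1) by (intro negligible_Union) auto
  moreover have "\<exists>D. (f has_vector_derivative D) (at x)" if x: "x \<in> {a<..<b} - \<Union>(N ` Basis)" for x
  proof -
    have "\<forall>i\<in>Basis. \<exists>D. ((\<lambda>s. f s \<bullet> i) has_real_derivative D) (at x)" using N(2) x by blast
    then obtain D where D: "\<And>i. i \<in> Basis \<Longrightarrow> ((\<lambda>s. f s \<bullet> i) has_real_derivative D i) (at x)" by metis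
    have "((\<lambda>s. \<Sum>i\<in>Basis. (f s \<bullet> i) *\<^sub>R i) has_vector_derivative (\<Sum>i\<in>Basis. D i *\<^sub>R i)) (at x)"
      using D by (auto intro!: derivative_eq_intros sum.cong)
    then show ?thesis by (auto simp: euclidean_representation)
  qed
  ultimately show ?thesis by blast
qed

section \<open>The fundamental theorem of calculus for absolutely continuous curves\<close>

text \<open>A null set lies in an open set of measure below the threshold that absolute continuity
  provides. The open set becomes the gauge at the exceptional tags.\<close>

lemma absolutely_continuous_on_small_over_null_set:
  fixes f :: "real \<Rightarrow> 'a::real_normed_vector"
  assumes f: "absolutely_continuous_on {a..b} f" and N: "negligible N" and e: "0 < e"
  obtains U where "open U" "N \<subseteq> U"
    "\<And>D. D division_of \<Union>D \<Longrightarrow> \<Union>D \<subseteq> {a..b} \<inter> U \<Longrightarrow> (\<Sum>k\<in>D. norm (f (Sup k) - f (Inf k))) < e"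
proof -
  obtain d where d: "0 < d"
    "\<And>D. D division_of \<Union>D \<Longrightarrow> \<Union>D \<subseteq> {a..b} \<Longrightarrow> (\<Sum>k\<in>D. Sup k - Inf k) < d \<Longrightarrow>
       (\<Sum>k\<in>D. norm (f (Sup k) - f (Inf k))) < e"
    using f e by (rule absolutely_continuous_onE) blast
  obtain U where U: "open U" "N \<subseteq> U" "U - N \<in> lmeasurable" "emeasure lebesgue (U - N) < ennreal d"
    using sets_lebesgue_outer_open[OF negligible_imp_sets[OF N] d(1)] by blast
  have UN: "U = (U - N) \<union> N" using U by auto
  have Um: "U \<in> lmeasurable"
    by (subst UN, rule fmeasurable.Un) (use U(3) negligible_imp_measurable[OF N] in auto)
  have "measure lebesgue U \<le> measure lebesgue (U - N) + measure lebesgue N"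
    by (subst UN, rule measure_Un_le) (use U(3) negligible_imp_sets[OF N] in \<open>auto simp: fmeasurableD\<close>)
  also have "\<dots> < d"
    using U(3,4) d(1) negligible_imp_measure0[OF N] by (simp add: emeasure_eq_measure2 ennreal_less_iff)
  finally have mU: "measure lebesgue U < d" .
  show thesis
  proof (rule that[OF U(1,2)])
    fix D assume D: "D division_of \<Union>D" "\<Union>D \<subseteq> {a..b} \<inter> U"
    have "measure lebesgue (\<Union>D) \<le> measure lebesgue U"
      using D Um lmeasurable_division[OF D(1)] by (intro measure_mono_fmeasurable) (auto simp: fmeasurableD)
    with mU have "(\<Sum>k\<in>D. Sup k - Inf k) < d" using sum_lengths_division[OF D(1)] by simp
    with d(2) D show "(\<Sum>k\<in>D. norm (f (Sup k) - f (Inf k))) < e" by blast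
  qed
qed

text \<open>In a fine Riemann sum, differentiability bounds the error at tags outside
  \<open>N\<close> by a multiple of the interval length. Intervals tagged in \<open>N\<close> lie in
  a small open set over which the increments of \<open>f\<close> are small in total.\<close>

theorem fundamental_theorem_of_calculus_absolutely_continuous:
  fixes f :: "real \<Rightarrow> 'a::euclidean_space"
  assumes ab: "a \<le> b" and f: "absolutely_continuous_on {a..b} f" and N: "negligible N"
    and der: "\<And>x. x \<in> {a..b} - N \<Longrightarrow> (f has_vector_derivative f' x) (at x within {a..b})"
  shows "(f' has_integral (f b - f a)) {a..b}"
proof -
  \<comment> \<open>With the integrand set to 0 on \<open>N\<close>, exceptional tags contribute
    only the increments of \<open>f\<close>.\<close>
  define h where "h x = (if x \<in> N then 0 else f' x)" for x
  have "(h has_integral (f b - f a)) (cbox a b)"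
    unfolding has_integral
  proof (intro allI impI)
    fix e :: real assume e: "0 < e"
    \<comment> \<open>The summand 1 covers \<open>a = b\<close> and makes
      \<open>e' * (b - a) < e / 2\<close> strict.\<close>
    define e' where "e' = e / (2 * (b - a + 1))"
    have e': "0 < e'" using e ab by (simp add: e'_def)
    have "\<exists>d>0. \<forall>y\<in>{a..b}. \<bar>y - x\<bar> < d \<longrightarrow> norm (f y - f x - (y - x) *\<^sub>R f' x) \<le> e' * \<bar>y - x\<bar>"
      if "x \<in> {a..b} - N" for x
      using der[OF that] e' unfolding has_vector_derivative_def has_derivative_within_alt by auto
    then obtain d where d: "\<And>x. x \<in> {a..b} - N \<Longrightarrow> 0 < d x"
      "\<And>x y. x \<in> {a..b} - N \<Longrightarrow> y \<in> {a..b} \<Longrightarrow> \<bar>y - x\<bar> < d x \<Longrightarrow>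
        norm (f y - f x - (y - x) *\<^sub>R f' x) \<le> e' * \<bar>y - x\<bar>"
      by metis
    have "0 < e / 2" using e by simp
    then obtain U where U: "open U" "N \<subseteq> U"
      "\<And>D. D division_of \<Union>D \<Longrightarrow> \<Union>D \<subseteq> {a..b} \<inter> U \<Longrightarrow> (\<Sum>k\<in>D. norm (f (Sup k) - f (Inf k))) < e / 2"
      by (rule absolutely_continuous_on_small_over_null_set[OF f N]) blast
    define \<gamma> where "\<gamma> x = (if x \<in> N then U else if x \<in> {a..b} then ball x (d x) else UNIV)" for x
    have gauge: "gauge \<gamma>"
      unfolding gauge_def \<gamma>_def using U(1,2) d(1) by (auto simp: centre_in_ball)
    have close: "norm ((\<Sum>(x, k)\<in>p. measure lborel k *\<^sub>R h x) - (f b - f a)) < e"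
      if p: "p tagged_division_of cbox a b" and fine: "\<gamma> fine p" for p
    proof -
      define p1 where "p1 = {(x, k) \<in> p. x \<in> N}"
      define p2 where "p2 = p - p1"
      have finp: "finite p" using p by (rule tagged_division_of_finite)
      have p12: "p1 \<subseteq> p" "p2 \<subseteq> p" by (auto simp: p1_def p2_def)
      have box: "\<exists>u v. k = {u..v} \<and> u \<le> x \<and> x \<le> v \<and> a \<le> u \<and> v \<le> b \<and> {u..v} \<subseteq> \<gamma> x" if xk: "(x, k) \<in> p" for x k
      proof -
        obtain u v where k: "k = cbox u v" using tagged_division_ofD(4)[OF p xk] by blast
        moreover have "x \<in> k" "k \<subseteq> cbox a b" using tagged_division_ofD(2,3)[OF p xk] by auto
        moreover have "k \<subseteq> \<gamma> x" using fine xk by (auto simp: fine_def)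
        ultimately show ?thesis by (intro exI[of _ u] exI[of _ v]) auto
      qed
      let ?E = "\<lambda>(x, k). measure lborel k *\<^sub>R h x - (f (Sup k) - f (Inf k))"
      have "(\<Sum>(x, k)\<in>p. f (Sup k) - f (Inf k)) = f b - f a"
        using additive_tagged_division_1[OF ab, of p f] p by simp
      then have "(\<Sum>(x, k)\<in>p. measure lborel k *\<^sub>R h x) - (f b - f a) = (\<Sum>xk\<in>p. ?E xk)"
        by (simp add: sum_subtractf case_prod_unfold)
      also have "\<dots> = (\<Sum>xk\<in>p2. ?E xk) + (\<Sum>xk\<in>p1. ?E xk)"
        unfolding p2_def by (rule sum.subset_diff[OF p12(1) finp])
      finally have "norm ((\<Sum>(x, k)\<in>p. measure lborel k *\<^sub>R h x) - (f b - f a)) \<le>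
          norm (\<Sum>xk\<in>p2. ?E xk) + norm (\<Sum>xk\<in>p1. ?E xk)"
        by (simp only: norm_triangle_ineq)
      also have "\<dots> \<le> (\<Sum>xk\<in>p2. norm (?E xk)) + (\<Sum>xk\<in>p1. norm (?E xk))"
        by (intro add_mono norm_sum)
      finally have "norm ((\<Sum>(x, k)\<in>p. measure lborel k *\<^sub>R h x) - (f b - f a)) \<le>
          (\<Sum>xk\<in>p2. norm (?E xk)) + (\<Sum>xk\<in>p1. norm (?E xk))" .
      moreover have "(\<Sum>xk\<in>p2. norm (?E xk)) < e / 2"
      proof -
        have "norm (?E (x, k)) \<le> e' * measure lborel k" if "(x, k) \<in> p2" for x k
        proof -
          have "(x, k) \<in> p" "x \<notin> N" using that by (auto simp: p2_def p1_def)
          then obtain u v where k: "k = {u..v}" "u \<le> x" "x \<le> v" "a \<le> u" "v \<le> b" "{u..v} \<subseteq> \<gamma> x"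
            using box by blast
          have x: "x \<in> {a..b} - N" using k \<open>x \<notin> N\<close> by auto
          have "u \<in> \<gamma> x" "v \<in> \<gamma> x" using k by auto
          then have "\<bar>u - x\<bar> < d x" "\<bar>v - x\<bar> < d x"
            using x by (auto simp: \<gamma>_def dist_real_def)
          then have "norm (f v - f x - (v - x) *\<^sub>R f' x) \<le> e' * (v - x)"
            "norm (f u - f x - (u - x) *\<^sub>R f' x) \<le> e' * (x - u)"
            using d(2)[OF x, of v] d(2)[OF x, of u] k by auto
          \<comment> \<open>Splitting the interval at its tag \<open>x\<close> reduces the error to
            the two one-sided errors.\<close>
          moreover have "norm ((v - u) *\<^sub>R f' x - (f v - f u)) \<le>
              norm (f v - f x - (v - x) *\<^sub>R f' x) + norm (f u - f x - (u - x) *\<^sub>R f' x)"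
          proof -
            have "(v - u) *\<^sub>R f' x - (f v - f u) =
                (f u - f x - (u - x) *\<^sub>R f' x) - (f v - f x - (v - x) *\<^sub>R f' x)"
              by (simp add: algebra_simps)
            then show ?thesis using norm_triangle_ineq4 by (metis add.commute)
          qed
          ultimately have "norm ((v - u) *\<^sub>R f' x - (f v - f u)) \<le> e' * (v - u)"
            by (simp add: algebra_simps)
          then show ?thesis using k \<open>x \<notin> N\<close> by (simp add: h_def)
        qed
        then have "(\<Sum>xk\<in>p2. norm (?E xk)) \<le> (\<Sum>(x, k)\<in>p2. e' * measure lborel k)"
          by (intro sum_mono) auto
        also have "\<dots> \<le> (\<Sum>(x, k)\<in>p. e' * measure lborel k)"
          using e' by (intro sum_mono2 finp p12) (auto simp: case_prod_unfold)
        also have "\<dots> = e' * (\<Sum>(x, k)\<in>p. measure lborel k)"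
          by (simp add: sum_distrib_left case_prod_unfold)
        also have "\<dots> = e' * (b - a)"
          using additive_content_tagged_division[OF p] ab by simp
        also have "\<dots> < e / 2" using e ab by (simp add: e'_def field_simps)
        finally show ?thesis .
      qed
      moreover have "(\<Sum>xk\<in>p1. norm (?E xk)) < e / 2"
      proof -
        \<comment> \<open>Passing from tagged pairs to intervals requires a summand that vanishes on
          every box without interior. The guard handles the empty box, where \<open>Sup\<close> and
          \<open>Inf\<close> have no useful values.\<close>
        let ?g = "\<lambda>k. if k = {} then 0 else norm (f (Sup k) - f (Inf k))"
        have part: "p1 tagged_partial_division_of cbox a b"
          using p p12(1) tagged_partial_division_subset unfolding tagged_division_of_def by blast
        have "norm (?E (x, k)) = ?g k" if xk: "(x, k) \<in> p1" for x k
        proof -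
          have "(x, k) \<in> p" "x \<in> N" using xk by (auto simp: p1_def)
          moreover from this have "k \<noteq> {}" using tagged_division_ofD(2)[OF p] by blast
          ultimately show ?thesis by (simp add: h_def norm_minus_commute)
        qed
        then have "(\<Sum>xk\<in>p1. norm (?E xk)) = (\<Sum>(x, k)\<in>p1. ?g k)"
          by (intro sum.cong) auto
        also have "\<dots> = (\<Sum>k\<in>snd ` p1. ?g k)"
        proof (rule sum.over_tagged_division_lemma[OF tagged_partial_division_of_Union_self[OF part]])
          fix u v :: real assume "box u v = {}"
          then have "v \<le> u" by simp
          then show "?g (cbox u v) = 0" by (cases "u = v") auto
        qed
        also have "\<dots> = (\<Sum>k\<in>snd ` p1. norm (f (Sup k) - f (Inf k)))"
        proof (rule sum.cong)
          fix k assume "k \<in> snd ` p1"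
          then obtain x where "(x, k) \<in> p" by (auto simp: p1_def)
          from tagged_division_ofD(2)[OF p this] have "k \<noteq> {}" by auto
          then show "?g k = norm (f (Sup k) - f (Inf k))" by simp
        qed simp
        also have "\<dots> < e / 2"
        proof (rule U(3)[OF partial_division_of_tagged_division[OF part]])
          have "k \<subseteq> {a..b} \<inter> U" if "(x, k) \<in> p1" for x k
            using box[of x k] that by (auto simp: p1_def \<gamma>_def)
          then show "\<Union>(snd ` p1) \<subseteq> {a..b} \<inter> U" by force
        qed
        finally show ?thesis .
      qed
      ultimately show ?thesis by linarith
    qed
    show "\<exists>\<gamma>. gauge \<gamma> \<and> (\<forall>p. p tagged_division_of cbox a b \<and> \<gamma> fine p \<longrightarrow>
        norm ((\<Sum>(x, k)\<in>p. measure lborel k *\<^sub>R h x) - (f b - f a)) < e)"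
    proof (intro exI[of _ \<gamma>] conjI allI impI)
      show "gauge \<gamma>" by (rule gauge)
      fix p assume "p tagged_division_of cbox a b \<and> \<gamma> fine p"
      then show "norm ((\<Sum>(x, k)\<in>p. measure lborel k *\<^sub>R h x) - (f b - f a)) < e"
        by (elim conjE) (rule close)
    qed
  qed
  then have "(h has_integral (f b - f a)) {a..b}" by simp
  then show ?thesis
    by (rule has_integral_spike[OF N, rotated]) (auto simp: h_def)
qed

subsection \<open>The extended Lebesgue integral\<close>

lemma ext_lebesgue_integral_cong:
  assumes "\<And>s. s \<in> S \<Longrightarrow> f s = h s"
  shows "ext_lebesgue_integral S f = ext_lebesgue_integral S h"
proof -
  have "(\<integral>\<^sup>+ s\<in>S. ennreal (f s) \<partial>lebesgue) = (\<integral>\<^sup>+ s\<in>S. ennreal (h s) \<partial>lebesgue)"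
    "(\<integral>\<^sup>+ s\<in>S. ennreal (- f s) \<partial>lebesgue) = (\<integral>\<^sup>+ s\<in>S. ennreal (- h s) \<partial>lebesgue)"
    using assms by (auto intro!: nn_integral_cong simp: indicator_def)
  then show ?thesis by (simp add: ext_lebesgue_integral_def)
qed

lemma ext_lebesgue_integral_eq:
  assumes "set_integrable lebesgue S f"
  shows "ext_lebesgue_integral S f = ereal (LINT s:S|lebesgue. f s)"
proof -
  let ?f = "\<lambda>s. indicator S s *\<^sub>R f s"
  have f: "integrable lebesgue ?f" using assms by (simp add: set_integrable_def)
  have ind: "ennreal (?f s) = ennreal (f s) * indicator S s" "ennreal (- ?f s) = ennreal (- f s) * indicator S s" for s
    by (auto simp: indicator_def)
  have fin: "(\<integral>\<^sup>+ s. ennreal (?f s) \<partial>lebesgue) \<noteq> \<infinity>" "(\<integral>\<^sup>+ s. ennreal (- ?f s) \<partial>lebesgue) \<noteq> \<infinity>"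
    using f by (simp_all only: real_integrable_def) auto
  have real: "enn2ereal r = ereal (enn2real r)" if "r \<noteq> \<infinity>" for r
    using that by (cases r) (auto simp: enn2ereal_ennreal)
  show ?thesis
    unfolding ext_lebesgue_integral_def set_lebesgue_integral_def real_lebesgue_integral_def[OF f]
    using real[OF fin(1)] real[OF fin(2)] unfolding ind by simp
qed

text \<open>The lower bound and the finite measure of \<open>S\<close> make the negative part
  integrable, so failure of integrability can only come from an infinite positive part.\<close>

lemma ext_lebesgue_integral_eq_infinity:
  assumes S: "S \<in> lmeasurable" and f: "f \<in> borel_measurable (lebesgue_on S)"
    and ge: "\<And>s. s \<in> S \<Longrightarrow> - C \<le> f s" and not: "\<not> set_integrable lebesgue S f"
  shows "ext_lebesgue_integral S f = \<infinity>"
proof -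
  let ?f = "\<lambda>s. indicator S s *\<^sub>R f s"
  have ind: "ennreal (?f s) = ennreal (f s) * indicator S s" "ennreal (- ?f s) = ennreal (- f s) * indicator S s" for s
    by (auto simp: indicator_def)
  have "?f \<in> borel_measurable lebesgue"
    using f S by (simp add: borel_measurable_restrict_space_iff fmeasurableD)
  then have inf: "(\<integral>\<^sup>+ s. ennreal (?f s) \<partial>lebesgue) = \<infinity> \<or> (\<integral>\<^sup>+ s. ennreal (- ?f s) \<partial>lebesgue) = \<infinity>"
    using not unfolding set_integrable_def real_integrable_def by auto
  have "(\<integral>\<^sup>+ s\<in>S. ennreal (- f s) \<partial>lebesgue) \<le> (\<integral>\<^sup>+ s\<in>S. ennreal C \<partial>lebesgue)"
    using ge by (intro nn_integral_mono) (force simp: indicator_def intro!: ennreal_leI)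
  also have "\<dots> = ennreal C * emeasure lebesgue S"
    using S by (intro nn_integral_cmult_indicator) (rule fmeasurableD)
  also have "\<dots> < \<infinity>" using fmeasurableD2[OF S] by (simp add: ennreal_mult_less_top less_top)
  finally have neg: "(\<integral>\<^sup>+ s\<in>S. ennreal (- f s) \<partial>lebesgue) < \<infinity>" .
  then have "(\<integral>\<^sup>+ s\<in>S. ennreal (f s) \<partial>lebesgue) = \<infinity>" using inf unfolding ind by (metis less_irrefl infinity_ennreal_def)
  moreover have "enn2ereal r \<noteq> \<infinity>" if "r < \<infinity>" for r
    using that by (cases r) (auto simp: enn2ereal_ennreal)
  ultimately show ?thesis using neg
    unfolding ext_lebesgue_integral_def by (simp add: ereal_minus_eq_PInfty_iff)
qed

subsection \<open>Coercive maps\<close>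

text \<open>If \<open>z\<close> were missed, pushing \<open>z - F u\<close> radially to the sphere
  of radius \<open>R\<close> would be a continuous self-map \<open>G\<close> of the ball. At a
  Brouwer fixed point, \<open>F u - z\<close> points against \<open>u\<close>, which coercivity
  forbids for large \<open>R\<close>.\<close>

lemma surj_coercive:
  fixes F :: "'a::euclidean_space \<Rightarrow> 'a"
  assumes cont: "continuous_on UNIV F"
    and coercive: "\<And>M. \<exists>C. \<forall>u. M * norm u - C \<le> F u \<bullet> u"
  shows "surj F"
proof (rule ccontr)
  assume "\<not> surj F"
  then obtain z where z: "\<And>u. F u \<noteq> z" by (metis surj_def)
  obtain C where C: "\<And>u. (norm z + 1) * norm u - C \<le> F u \<bullet> u" using coercive by blast
  \<comment> \<open>At \<open>norm u = R\<close>, coercivity and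
    \<open>F u \<bullet> u < norm z * R\<close> would give \<open>R < C\<close>.\<close>
  define R where "R = max C 0 + 1"
  have R: "0 < R" "C < R" by (auto simp: R_def)
  define G where "G u = - (R / norm (F u - z)) *\<^sub>R (F u - z)" for u
  have nG: "norm (G u) = R" for u using R z[of u] by (simp add: G_def)
  have "continuous_on (cball 0 R) G"
    unfolding G_def using z by (intro continuous_intros continuous_on_subset[OF cont]) auto
  moreover have "G \<in> cball 0 R \<rightarrow> cball 0 R" using nG by auto
  ultimately obtain u where u: "G u = u" using brouwer_ball[OF R(1)] by blast
  have nu: "norm u = R" using nG[of u] u by simp
  have "(F u - z) \<bullet> u = (F u - z) \<bullet> G u" using u by simp
  also have "\<dots> = - (R / norm (F u - z)) * ((F u - z) \<bullet> (F u - z))"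
    unfolding G_def by (rule inner_scaleR_right)
  also have "\<dots> < 0" using R z[of u] by (simp add: divide_pos_pos)
  finally have "F u \<bullet> u < z \<bullet> u" by (simp add: inner_diff_left)
  also have "\<dots> \<le> norm z * R" using norm_cauchy_schwarz[of z u] nu by simp
  finally show False using C[of u] R nu by (simp add: algebra_simps)
qed

lemma continuous_coercive_attains_min:
  fixes F :: "'a::euclidean_space \<Rightarrow> real"
  assumes cont: "continuous_on UNIV F" and coercive: "\<And>B. \<exists>R. \<forall>p. R \<le> norm p \<longrightarrow> B \<le> F p"
  obtains p where "\<And>q. F p \<le> F q"
proof -
  obtain R where R: "\<And>p. R \<le> norm p \<Longrightarrow> F 0 \<le> F p" using coercive by blast
  have "\<exists>p\<in>cball 0 (max R 0). \<forall>q\<in>cball 0 (max R 0). F p \<le> F q"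
    by (rule continuous_attains_inf) (auto intro: continuous_on_subset[OF cont])
  then obtain p where "\<forall>q\<in>cball 0 (max R 0). F p \<le> F q" by blast
  then have p: "F p \<le> F q" if "norm q \<le> max R 0" for q using that by simp
  show thesis
  proof
    fix q
    show "F p \<le> F q"
    proof (cases "norm q \<le> max R 0")
      case False
      then have "F 0 \<le> F q" by (intro R) simp
      moreover have "F p \<le> F 0" by (rule p) simp
      ultimately show ?thesis by simp
    qed (rule p)
  qed
qed

subsection \<open>Inverting the gradient\<close>

locale superlinear_convex =
  fixes l :: "'a::euclidean_space \<Rightarrow> real"
  assumes smooth: "twice_continuously_differentiable l"
    and strict: "strictly_convex l"
    and superlinear: "filterlim (\<lambda>u. l u / norm u) at_top at_infinity"
begin

lemma gradient: "GDERIV l u :> gradient l u" and continuous_gradient: "continuous_on UNIV (gradient l)"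
proof -
  obtain f' f'' where f': "\<And>x. (l has_derivative blinfun_apply (f' x)) (at x)"
    and f'': "\<And>x. (f' has_derivative blinfun_apply (f'' x)) (at x)"
    using smooth unfolding twice_continuously_differentiable_def by blast
  \<comment> \<open>This vector represents the derivative through the inner product; its uniqueness
    then identifies it with the definite description \<open>gradient l u\<close>.\<close>
  define D where "D u = (\<Sum>b\<in>Basis. blinfun_apply (f' u) b *\<^sub>R b)" for u
  have D: "GDERIV l u :> D u" for u
  proof -
    have "blinfun_apply (f' u) h = h \<bullet> D u" for h
    proof -
      have "blinfun_apply (f' u) h = blinfun_apply (f' u) (\<Sum>b\<in>Basis. (h \<bullet> b) *\<^sub>R b)"
        by (simp add: euclidean_representation)
      also have "\<dots> = h \<bullet> D u"
        by (simp add: D_def blinfun.sum_right blinfun.scaleR_right inner_sum_right mult.commute)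
      finally show ?thesis .
    qed
    then have "blinfun_apply (f' u) = (\<lambda>h. h \<bullet> D u)" by auto
    with f'[of u] show ?thesis by (simp add: gderiv_def)
  qed
  have grad: "gradient l u = D u" for u
    unfolding gradient_def
  proof (rule the_equality)
    show "GDERIV l u :> D u" by (rule D)
    fix E assume "GDERIV l u :> E"
    then have "(\<lambda>h. h \<bullet> E) = (\<lambda>h. h \<bullet> D u)"
      using D unfolding gderiv_def by (blast intro: has_derivative_unique)
    then have "h \<bullet> E = h \<bullet> D u" for h by meson
    then show "E = D u" by (metis vector_eq_rdot inner_commute)
  qed
  show "GDERIV l u :> gradient l u" using D grad by simp
  have "continuous_on UNIV f'"
    using f'' by (meson continuous_at_imp_continuous_on has_derivative_continuous)
  then show "continuous_on UNIV (gradient l)"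
    unfolding grad[abs_def] D_def by (intro continuous_intros)
qed

lemma continuous_l: "continuous_on S l"
  using gradient unfolding gderiv_def
  by (meson continuous_at_imp_continuous_on has_derivative_continuous)

text \<open>By convexity the chord slopes from \<open>u\<close> towards \<open>w\<close> are at most
  \<open>l w - l u\<close>; letting the step tend to 0 from the right gives the directional
  derivative.\<close>

lemma tangent_le: "l u + gradient l u \<bullet> (w - u) \<le> l w"
proof (cases "u = w")
  case False
  have "((\<lambda>h. u + h *\<^sub>R (w - u)) has_derivative (\<lambda>h. h *\<^sub>R (w - u))) (at 0)"
    by (auto intro!: derivative_eq_intros)
  moreover have "(l has_derivative (\<lambda>h. h \<bullet> gradient l u)) (at (u + 0 *\<^sub>R (w - u)))"
    using gradient[of u] by (simp add: gderiv_def)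
  ultimately have "((\<lambda>h. l (u + h *\<^sub>R (w - u))) has_derivative (\<lambda>h. h *\<^sub>R (w - u) \<bullet> gradient l u)) (at 0)"
    by (rule has_derivative_compose)
  then have "((\<lambda>h. l (u + h *\<^sub>R (w - u))) has_field_derivative ((w - u) \<bullet> gradient l u)) (at 0)"
    by (simp add: has_field_derivative_def mult_commute_abs)
  then have "((\<lambda>h. (l (u + h *\<^sub>R (w - u)) - l u) / h) \<longlongrightarrow> (w - u) \<bullet> gradient l u) (at 0)"
    by (simp add: DERIV_def)
  then have "((\<lambda>h. (l (u + h *\<^sub>R (w - u)) - l u) / h) \<longlongrightarrow> (w - u) \<bullet> gradient l u) (at_right 0)"
    by (rule filterlim_mono) (auto simp: at_within_le_nhds intro: at_le)
  moreover have "\<forall>\<^sub>F h in at_right 0. (l (u + h *\<^sub>R (w - u)) - l u) / h \<le> l w - l u"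
    unfolding eventually_at_right_field
  proof (intro exI[of _ 1] conjI allI impI)
    fix h :: real assume h: "0 < h" "h < 1"
    have "l ((1 - h) *\<^sub>R u + h *\<^sub>R w) < (1 - h) * l u + h * l w"
      using strict False h unfolding strictly_convex_def by blast
    moreover have "(1 - h) *\<^sub>R u + h *\<^sub>R w = u + h *\<^sub>R (w - u)" by (simp add: algebra_simps)
    ultimately have "l (u + h *\<^sub>R (w - u)) - l u \<le> (l w - l u) * h" by (simp add: algebra_simps)
    then show "(l (u + h *\<^sub>R (w - u)) - l u) / h \<le> l w - l u"
      using h by (simp add: pos_divide_le_eq)
  qed simp
  ultimately have "(w - u) \<bullet> gradient l u \<le> l w - l u"
    by (rule tendsto_upperbound) simp
  then show ?thesis by (simp add: inner_commute)
qed simp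

text \<open>Outside a large ball superlinearity gives the bound directly; on the ball
  \<open>l\<close> has a minimum, and the constant absorbs the rest. \<open>M\<close> may be
  negative, hence the absolute value in the constant.\<close>

lemma superlinear_bound: obtains C where "0 \<le> C" "\<And>u. M * norm u - C \<le> l u"
proof -
  have "\<forall>\<^sub>F u in at_infinity. M \<le> l u / norm u"
    using superlinear unfolding filterlim_at_top by blast
  then obtain R where R: "\<And>u. R \<le> norm u \<Longrightarrow> M \<le> l u / norm u"
    unfolding eventually_at_infinity by blast
  define r where "r = max R 1"
  have big: "M * norm u \<le> l u" if "r \<le> norm u" for u
  proof -
    have "R \<le> norm u" "0 < norm u" using that by (auto simp: r_def)
    with R[of u] show ?thesis by (simp add: pos_le_divide_eq)
  qed
  have "\<exists>u\<in>cball 0 r. \<forall>w\<in>cball 0 r. l u \<le> l w"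
    by (rule continuous_attains_inf) (auto intro: continuous_l simp: r_def)
  then obtain v where "\<forall>w\<in>cball 0 r. l v \<le> l w" by blast
  then have m: "l v \<le> l w" if "norm w \<le> r" for w using that by simp
  show thesis
  proof (rule that[of "\<bar>M\<bar> * r + \<bar>l v\<bar>"])
    show "0 \<le> \<bar>M\<bar> * r + \<bar>l v\<bar>" by (simp add: r_def)
    fix u
    show "M * norm u - (\<bar>M\<bar> * r + \<bar>l v\<bar>) \<le> l u"
    proof (cases "r \<le> norm u")
      case True
      have "0 \<le> \<bar>M\<bar> * r" by (simp add: r_def)
      with big[OF True] show ?thesis by linarith
    next
      case False
      then have "M * norm u \<le> \<bar>M\<bar> * r" by (intro mult_mono) auto
      moreover have "l v \<le> l u" using False by (intro m) simp
      ultimately show ?thesis by linarith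
    qed
  qed
qed

text \<open>The tangent inequality from \<open>u\<close> to 0 makes the gradient coercive, hence
  surjective. If two points had the same gradient, adding their tangent inequalities at the midpoint
  would contradict strict convexity.\<close>

lemma bij_gradient: "bij (gradient l)"
proof (rule bijI)
  show "surj (gradient l)"
  proof (rule surj_coercive[OF continuous_gradient])
    fix M :: real
    obtain C where C: "\<And>u. M * norm u - C \<le> l u" using superlinear_bound by blast
    have "M * norm u - (C + l 0) \<le> gradient l u \<bullet> u" for u
      using C[of u] tangent_le[of u 0] by simp
    then show "\<exists>C. \<forall>u. M * norm u - C \<le> gradient l u \<bullet> u" by blast
  qed
  show "inj (gradient l)"
  proof (rule injI, rule ccontr)
    fix u w assume eq: "gradient l u = gradient l w" and ne: "u \<noteq> w"
    define m where "m = (1 - 1/2) *\<^sub>R u + (1/2) *\<^sub>R w"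
    have "l m < (1 - 1/2) * l u + (1/2) * l w"
      unfolding m_def
      by (rule strict[unfolded strictly_convex_def, rule_format]) (use ne in auto)
    moreover have "l u + gradient l u \<bullet> (m - u) \<le> l m" "l w + gradient l u \<bullet> (m - w) \<le> l m"
      using tangent_le[of u m] tangent_le[of w m] eq by auto
    moreover have "(m - u) + (m - w) = 0"
      by (simp add: m_def algebra_simps flip: scaleR_add_left)
    then have "gradient l u \<bullet> (m - u) + gradient l u \<bullet> (m - w) = 0"
      by (metis inner_add_right inner_zero_right)
    ultimately show False by simp
  qed
qed

definition \<iota> :: "'a \<Rightarrow> 'a" where "\<iota> = inv (gradient l)"

lemma gradient_\<iota>: "gradient l (\<iota> q) = q"
  using bij_gradient by (simp add: \<iota>_def bij_is_surj surj_f_inv_f)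

text \<open>By invariance of domain, the continuous injective gradient is a homeomorphism onto its
  image.\<close>

lemma continuous_\<iota>: "continuous_on S \<iota>"
proof -
  obtain h where h: "homeomorphism UNIV (gradient l ` UNIV) (gradient l) h"
    using invariance_of_domain_homeomorphism[OF open_UNIV continuous_gradient]
      bij_is_inj[OF bij_gradient] by blast
  have "h q = \<iota> q" for q
    using homeomorphism_apply1[OF h, of "\<iota> q"] by (simp add: gradient_\<iota>)
  then have "h = \<iota>" by blast
  then show ?thesis
    using homeomorphism_cont2[OF h] bij_is_surj[OF bij_gradient] continuous_on_subset[of UNIV \<iota> S] by auto
qed

text \<open>The tangent inequality from \<open>\<iota> q\<close> to the point
  \<open>M *\<^sub>R sgn q\<close> gives \<open>M * norm q + l (\<iota> q) - l (M *\<^sub>R sgn q)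
  \<le> q \<bullet> \<iota> q\<close>. Here \<open>l\<close> is bounded below everywhere and bounded
  above on the ball of radius \<open>\<bar>M\<bar>\<close>.\<close>

lemma \<iota>_coercive: obtains C where "0 \<le> C" "\<And>q. M * norm q - C \<le> q \<bullet> \<iota> q"
proof -
  obtain C where C: "0 \<le> C" "\<And>u. 0 * norm u - C \<le> l u" using superlinear_bound by blast
  have "\<exists>u\<in>cball 0 \<bar>M\<bar>. \<forall>w\<in>cball 0 \<bar>M\<bar>. l w \<le> l u"
    by (rule continuous_attains_sup) (auto intro: continuous_l)
  then obtain v where "\<forall>w\<in>cball 0 \<bar>M\<bar>. l w \<le> l v" by blast
  then have B: "l w \<le> l v" if "norm w \<le> \<bar>M\<bar>" for w using that by simp
  show thesis
  proof (rule that[of "C + \<bar>l v\<bar>"])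
    fix q
    have "l (\<iota> q) + q \<bullet> (M *\<^sub>R sgn q - \<iota> q) \<le> l (M *\<^sub>R sgn q)"
      using tangent_le[of "\<iota> q"] by (simp add: gradient_\<iota>)
    moreover have "l (M *\<^sub>R sgn q) \<le> l v" by (rule B) (simp add: norm_sgn)
    moreover have "q \<bullet> (M *\<^sub>R sgn q) = M * norm q"
      by (cases "q = 0") (simp_all add: sgn_div_norm power2_norm_eq_inner[symmetric] power2_eq_square)
    ultimately show "M * norm q - (C + \<bar>l v\<bar>) \<le> q \<bullet> \<iota> q"
      using C(2)[of "\<iota> q"] unfolding inner_diff_right by linarith
  qed (use C in simp)
qed

end


subsection \<open>The discounted problem\<close>

text \<open>The initial time is fixed throughout, so the discount enters as one function \<delta> of
  \<open>s\<close>, later instantiated with \<open>d t\<close>.\<close>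

locale discounted_superlinear_convex = superlinear_convex l
  for l :: "'a::euclidean_space \<Rightarrow> real" +
  fixes \<delta> :: "real \<Rightarrow> real" and t T a :: real
  assumes t_less_T: "t < T" and a_pos: "0 < a"
    and continuous_\<delta>: "continuous_on {t..T} \<delta>"
    and \<delta>_bounds: "\<And>s. s \<in> {t..T} \<Longrightarrow> a \<le> \<delta> s" "\<And>s. s \<in> {t..T} \<Longrightarrow> \<delta> s \<le> 1"
begin

section \<open>Displacement and running cost as functions of \<open>p\<close>\<close>

definition velocity :: "'a \<Rightarrow> real \<Rightarrow> 'a" where
  "velocity p s = \<iota> (inverse (\<delta> s) *\<^sub>R p)"

definition displacement :: "'a \<Rightarrow> 'a" where
  "displacement p = integral {t..T} (velocity p)"

definition running_cost :: "'a \<Rightarrow> real" where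
  "running_cost p = integral {t..T} (\<lambda>s. \<delta> s * l (velocity p s))"

lemma \<delta>_pos: "s \<in> {t..T} \<Longrightarrow> 0 < \<delta> s"
  using \<delta>_bounds(1) a_pos by force

text \<open>Joint continuity is what yields continuity in \<open>p\<close> after integration over
  \<open>s\<close>.\<close>

lemma continuous_velocity_pair: "continuous_on (UNIV \<times> {t..T}) (\<lambda>(p, s). velocity p s)"
proof -
  have "continuous_on (UNIV \<times> {t..T}) (\<lambda>ps :: 'a \<times> real. inverse (\<delta> (snd ps)) *\<^sub>R fst ps)"
    using \<delta>_pos by (intro continuous_intros continuous_on_compose2[OF continuous_\<delta>]) fastforce+
  then show ?thesis
    unfolding velocity_def case_prod_unfold
    by (intro continuous_on_compose2[OF continuous_\<iota>[of UNIV]]) auto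
qed

lemma continuous_velocity: "continuous_on {t..T} (velocity p)"
proof -
  have "continuous_on {t..T} (\<lambda>s. case (p, s) of (p, s) \<Rightarrow> velocity p s)"
    by (rule continuous_on_compose2[OF continuous_velocity_pair]) (auto intro!: continuous_intros)
  then show ?thesis by simp
qed

lemma continuous_lagrangian_pair: "continuous_on (UNIV \<times> {t..T}) (\<lambda>(p, s). \<delta> s * l (velocity p s))"
  using continuous_velocity_pair unfolding case_prod_unfold
  by (intro continuous_intros continuous_on_compose2[OF continuous_\<delta>]
      continuous_on_compose2[OF continuous_l[of UNIV]]) auto

lemma continuous_lagrangian: "continuous_on {t..T} (\<lambda>s. \<delta> s * l (velocity p s))"
  by (intro continuous_intros continuous_\<delta> continuous_velocity
      continuous_on_compose2[OF continuous_l[of UNIV]]) auto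

lemma continuous_displacement: "continuous_on UNIV displacement"
  using integral_continuous_on_param[of UNIV t T velocity] continuous_velocity_pair
  by (simp add: displacement_def[abs_def])

lemma continuous_running_cost: "continuous_on UNIV running_cost"
  using integral_continuous_on_param[of UNIV t T "\<lambda>p s. \<delta> s * l (velocity p s)"] continuous_lagrangian_pair
  by (simp add: running_cost_def[abs_def])

lemma inner_displacement: "((\<lambda>s. p \<bullet> velocity q s) has_integral (p \<bullet> displacement q)) {t..T}"
proof -
  have "(velocity q has_integral displacement q) {t..T}"
    unfolding displacement_def
    by (intro integrable_integral integrable_continuous_interval continuous_velocity)
  from has_integral_linear[OF this bounded_linear_inner_right[of p]]
  show ?thesis by (simp add: o_def)
qed

text \<open>Applying \<open>\<iota>_coercive\<close> to \<open>p / \<delta> s\<close> and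
  multiplying by \<open>\<delta> s\<close> cancels the discount in the linear term and only shrinks
  the constant. The pointwise bound is then integrated.\<close>

lemma displacement_coercive: "\<exists>C. \<forall>p. M * norm p - C \<le> displacement p \<bullet> p"
proof -
  \<comment> \<open>Integration over \<open>{t..T}\<close> restores the slope
    \<open>M\<close>.\<close>
  define K where "K = M / (T - t)"
  obtain C where C: "0 \<le> C" "\<And>q. K * norm q - C \<le> q \<bullet> \<iota> q" using \<iota>_coercive by blast
  have "M * norm p - (T - t) * C \<le> displacement p \<bullet> p" for p
  proof -
    have "K * norm p - C \<le> p \<bullet> velocity p s" if s: "s \<in> {t..T}" for s
    proof -
      have "K * norm p - \<delta> s * C = \<delta> s * (K * norm (inverse (\<delta> s) *\<^sub>R p) - C)"
        using \<delta>_pos[OF s] by (simp add: field_simps)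
      also have "\<dots> \<le> \<delta> s * ((inverse (\<delta> s) *\<^sub>R p) \<bullet> velocity p s)"
        unfolding velocity_def using \<delta>_pos[OF s] by (intro mult_left_mono C) simp
      also have "\<dots> = p \<bullet> velocity p s" using \<delta>_pos[OF s] by simp
      finally show ?thesis
        using mult_right_mono[OF \<delta>_bounds(2)[OF s] C(1)] by simp
    qed
    then have "(T - t) *\<^sub>R (K * norm p - C) \<le> p \<bullet> displacement p"
      using has_integral_le[OF has_integral_const_real[of "K * norm p - C" t T] inner_displacement]
        t_less_T by (simp add: mult.commute)
    moreover have "(T - t) * (K * norm p - C) = M * norm p - (T - t) * C"
      using t_less_T by (simp add: K_def field_simps)
    ultimately show ?thesis by (simp add: inner_commute)
  qed
  then show ?thesis by blast
qed

lemma surj_displacement: "surj displacement"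
  by (rule surj_coercive[OF continuous_displacement displacement_coercive])

lemma displacement_at_infinity: "\<exists>R. \<forall>p. R \<le> norm p \<longrightarrow> B \<le> norm (displacement p)"
proof -
  obtain C where C: "\<And>p. (B + 1) * norm p - C \<le> displacement p \<bullet> p"
    using displacement_coercive by blast
  \<comment> \<open>The extra unit of slope absorbs \<open>C\<close>, and the bound 1 makes it
    possible to divide by \<open>norm p\<close>.\<close>
  have "B \<le> norm (displacement p)" if "max C 1 \<le> norm p" for p
  proof -
    have "B * norm p \<le> displacement p \<bullet> p" using C[of p] that by (simp add: algebra_simps)
    also have "\<dots> \<le> norm (displacement p) * norm p" by (rule norm_cauchy_schwarz)
    finally show ?thesis using that by (cases "p = 0") auto
  qed
  then show ?thesis by blast
qed

text \<open>Any linear growth in the displacement is dominated by the running cost; this will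
  outweigh the Lipschitz terminal cost.\<close>

lemma running_cost_lower_bound:
  assumes M: "0 \<le> M"
  shows "\<exists>C. \<forall>p. M * norm (displacement p) - C \<le> running_cost p"
proof -
  \<comment> \<open>The slope \<open>M / a\<close> compensates for a discount as small as
    \<open>a\<close>.\<close>
  obtain C where C: "0 \<le> C" "\<And>u. M / a * norm u - C \<le> l u" using superlinear_bound by blast
  have "M * norm (displacement p) - (T - t) * C \<le> running_cost p" for p
  proof -
    have le: "M * norm (velocity p s) - C \<le> \<delta> s * l (velocity p s)" if s: "s \<in> {t..T}" for s
    proof -
      have "M * norm (velocity p s) \<le> \<delta> s * (M / a * norm (velocity p s))"
        using mult_right_mono[OF \<delta>_bounds(1)[OF s], of "M / a * norm (velocity p s)"] M a_pos by simp
      moreover have "\<delta> s * (M / a * norm (velocity p s) - C) \<le> \<delta> s * l (velocity p s)"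
        using \<delta>_pos[OF s] by (intro mult_left_mono C) simp
      moreover have "\<delta> s * C \<le> 1 * C" by (intro mult_right_mono \<delta>_bounds(2)[OF s] C(1))
      ultimately show ?thesis by (simp add: right_diff_distrib)
    qed
    have norm_int: "(\<lambda>s. norm (velocity p s)) integrable_on {t..T}"
      by (intro integrable_continuous_interval continuous_intros continuous_velocity)
    have "norm (displacement p) \<le> integral {t..T} (\<lambda>s. norm (velocity p s))"
      unfolding displacement_def
      by (intro integral_norm_bound_integral norm_int integrable_continuous_interval continuous_velocity) simp
    then have "M * norm (displacement p) - (T - t) * C \<le>
        M * integral {t..T} (\<lambda>s. norm (velocity p s)) - (T - t) * C"
      using M by (simp add: mult_left_mono)
    also have "\<dots> = integral {t..T} (\<lambda>s. M * norm (velocity p s) - C)"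
      using norm_int t_less_T by (subst integral_diff) (auto intro!: integrable_on_mult_right)
    also have "\<dots> \<le> running_cost p"
      unfolding running_cost_def
      by (intro integral_le integrable_continuous_interval continuous_lagrangian le
          continuous_intros continuous_velocity)
    finally show ?thesis .
  qed
  then show ?thesis by blast
qed

text \<open>The terminal cost loses at most \<open>L\<close> times the displacement plus
  \<open>\<bar>g x\<bar>\<close>. A running cost of slope \<open>L + 1\<close> leaves one full
  multiple of the displacement, which tends to infinity with \<open>p\<close>.\<close>

lemma objective_attains_min:
  assumes g: "L-lipschitz_on UNIV g"
  obtains p where
    "\<And>q. running_cost p + \<delta> T * g (x + displacement p) \<le> running_cost q + \<delta> T * g (x + displacement q)"
proof -
  have L: "0 \<le> L" using g by (rule lipschitz_on_nonneg)
  have \<delta>T: "0 < \<delta> T" "\<delta> T \<le> 1" using \<delta>_pos \<delta>_bounds(2) t_less_T by auto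
  have continuous: "continuous_on UNIV (\<lambda>p. running_cost p + \<delta> T * g (x + displacement p))"
    by (intro continuous_intros continuous_running_cost continuous_displacement
        continuous_on_compose2[OF lipschitz_on_continuous_on[OF g]]) auto
  have coercive: "\<exists>R. \<forall>p. R \<le> norm p \<longrightarrow> B \<le> running_cost p + \<delta> T * g (x + displacement p)" for B
  proof -
    obtain C where C: "\<And>p. (L + 1) * norm (displacement p) - C \<le> running_cost p"
      using running_cost_lower_bound[of "L + 1"] L by auto
    obtain R where R: "\<And>p. R \<le> norm p \<Longrightarrow> B + C + \<bar>g x\<bar> \<le> norm (displacement p)"
      using displacement_at_infinity by blast
    have "B \<le> running_cost p + \<delta> T * g (x + displacement p)" if "R \<le> norm p" for p
    proof -
      have "\<bar>g (x + displacement p) - g x\<bar> \<le> L * norm (displacement p)"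
        using lipschitz_onD[OF g, of "x + displacement p" x] by (simp add: dist_norm)
      then have "\<bar>g (x + displacement p)\<bar> \<le> L * norm (displacement p) + \<bar>g x\<bar>" by linarith
      then have "\<delta> T * \<bar>g (x + displacement p)\<bar> \<le> 1 * (L * norm (displacement p) + \<bar>g x\<bar>)"
        using \<delta>T by (intro mult_mono) auto
      moreover have "\<delta> T * (- \<bar>g (x + displacement p)\<bar>) \<le> \<delta> T * g (x + displacement p)"
        using \<delta>T by (intro mult_left_mono) auto
      ultimately show ?thesis using C[of p] R[OF that] by (simp add: algebra_simps)
    qed
    then show ?thesis by blast
  qed
  from continuous_coercive_attains_min[OF continuous coercive] obtain p where
    "\<And>q. running_cost p + \<delta> T * g (x + displacement p) \<le> running_cost q + \<delta> T * g (x + displacement q)"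
    by blast
  then show thesis by (rule that)
qed

section \<open>Candidate trajectories and comparison with arbitrary curves\<close>

definition trajectory :: "'a \<Rightarrow> 'a \<Rightarrow> real \<Rightarrow> 'a" where
  "trajectory x p s = x + integral {t..s} (velocity p)"

lemma trajectory_T: "trajectory x p T = x + displacement p"
  by (simp add: trajectory_def displacement_def)

lemma trajectory_has_derivative:
  assumes s: "s \<in> {t..T}"
  shows "(trajectory x p has_vector_derivative velocity p s) (at s within {t..T})"
  unfolding trajectory_def[abs_def]
  using integral_has_vector_derivative[OF continuous_velocity s] by (auto intro!: derivative_eq_intros)

lemma trajectory_in_AC: "trajectory x p \<in> AC T x t"
proof -
  have "bounded (velocity p ` {t..T})"
    by (intro compact_imp_bounded compact_continuous_image continuous_velocity) simp
  then obtain B where B: "0 < B" "\<And>s. s \<in> {t..T} \<Longrightarrow> norm (velocity p s) \<le> B"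
    unfolding bounded_pos by auto
  have "B-lipschitz_on {t..T} (trajectory x p)"
  proof (rule bounded_derivative_imp_lipschitz)
    show "(trajectory x p has_derivative (\<lambda>h. h *\<^sub>R velocity p s)) (at s within {t..T})" if "s \<in> {t..T}" for s
      using trajectory_has_derivative[OF that] by (simp add: has_vector_derivative_def)
    show "onorm (\<lambda>h. h *\<^sub>R velocity p s) \<le> B" if "s \<in> {t..T}" for s
    proof (rule onorm_le)
      fix h
      show "norm (h *\<^sub>R velocity p s) \<le> B * norm h"
        using mult_left_mono[OF B(2)[OF that], of "\<bar>h\<bar>"] by (simp add: mult.commute)
    qed
  qed (use B(1) in auto)
  then show ?thesis
    by (simp add: AC_def trajectory_def lipschitz_imp_absolutely_continuous_on)
qed

lemma trajectory_running_cost: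
  "ext_lebesgue_integral {t..T} (\<lambda>s. \<delta> s * l (vector_derivative (trajectory x p) (at s within {t..T})))
    = ereal (running_cost p)"
proof -
  have "vector_derivative (trajectory x p) (at s within {t..T}) = velocity p s" if "s \<in> {t..T}" for s
    by (rule vector_derivative_within_closed_interval[OF t_less_T that trajectory_has_derivative[OF that]])
  then have "ext_lebesgue_integral {t..T} (\<lambda>s. \<delta> s * l (vector_derivative (trajectory x p) (at s within {t..T})))
      = ext_lebesgue_integral {t..T} (\<lambda>s. \<delta> s * l (velocity p s))"
    by (intro ext_lebesgue_integral_cong) simp
  moreover have "set_integrable lebesgue {t..T} (\<lambda>s. \<delta> s * l (velocity p s))"
    by (intro absolutely_integrable_continuous_real continuous_lagrangian)
  ultimately show ?thesis
    by (simp add: ext_lebesgue_integral_eq set_lebesgue_integral_eq_integral(2) running_cost_def)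
qed

text \<open>The tangent inequality at \<open>velocity p s\<close>, whose gradient is \<open>p / \<delta> s\<close>, becomes linear in the
  curve's velocity with the constant slope \<open>p\<close> once it is multiplied by \<open>\<delta> s\<close>; so its integral
  depends on the endpoints alone.\<close>

lemma running_cost_le:
  assumes y: "absolutely_continuous_on {t..T} y" and p: "y T - y t = displacement p"
  shows "ereal (running_cost p) \<le>
    ext_lebesgue_integral {t..T} (\<lambda>s. \<delta> s * l (vector_derivative y (at s within {t..T})))"
proof -
  define Y where "Y s = vector_derivative y (at s within {t..T})" for s
  define I where "I s = \<delta> s * l (Y s)" for s
  obtain N where N: "negligible N" "\<And>s. s \<in> {t<..<T} - N \<Longrightarrow> \<exists>D. (y has_vector_derivative D) (at s)"
    using absolutely_continuous_on_differentiable[OF y] by blast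
  have Y: "(Y has_integral (y T - y t)) {t..T}"
  proof (rule fundamental_theorem_of_calculus_absolutely_continuous[OF _ y])
    \<comment> \<open>The endpoints join the exceptional set because differentiability is known only
      in the open interval.\<close>
    show "negligible (N \<union> {t, T})" using N(1) by simp
    fix s assume "s \<in> {t..T} - (N \<union> {t, T})"
    then have "s \<in> {t<..<T} - N" by auto
    then obtain D where "(y has_vector_derivative D) (at s)" using N(2) by blast
    then have "(y has_vector_derivative D) (at s within {t..T})"
      by (rule has_vector_derivative_at_within)
    then show "(y has_vector_derivative Y s) (at s within {t..T})"
      unfolding Y_def by (metis differentiableI_vector vector_derivative_works)
  qed (use t_less_T in simp)
  obtain C where C: "0 \<le> C" "\<And>u. 0 * norm u - C \<le> l u" using superlinear_bound by blast
  have lower: "- C \<le> I s" if "s \<in> {t..T}" for s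
  proof -
    have "\<delta> s * (- C) \<le> I s"
      unfolding I_def using \<delta>_pos[OF that] C(2)[of "Y s"] by (intro mult_left_mono) auto
    moreover have "\<delta> s * C \<le> 1 * C" by (intro mult_right_mono \<delta>_bounds(2)[OF that] C(1))
    ultimately show ?thesis by simp
  qed
  show ?thesis
  proof (cases "set_integrable lebesgue {t..T} I")
    \<comment> \<open>A curve whose running cost is not integrable has cost \<infinity>, so the
      inequality is trivial once measurability and the lower bound are known.\<close>
    case False
    have "Y \<in> borel_measurable (lebesgue_on {t..T})"
      using Y by (intro integrable_imp_measurable) blast
    moreover have "\<delta> \<in> borel_measurable (lebesgue_on {t..T})"
      by (intro continuous_imp_measurable_on_sets_lebesgue continuous_\<delta>) simp
    moreover have "l \<in> borel_measurable borel"
      by (intro borel_measurable_continuous_onI continuous_l)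
    ultimately have "I \<in> borel_measurable (lebesgue_on {t..T})"
      unfolding I_def by (intro borel_measurable_times measurable_compose[of Y _ borel l])
    then have "ext_lebesgue_integral {t..T} I = \<infinity>"
      using lower False by (intro ext_lebesgue_integral_eq_infinity[of _ _ C]) auto
    then show ?thesis by (simp add: I_def[abs_def] Y_def)
  next
    case True
    then have I: "(I has_integral (LINT s:{t..T}|lebesgue. I s)) {t..T}"
      by (simp add: has_integral_set_lebesgue)
    have "((\<lambda>s. p \<bullet> Y s) has_integral (p \<bullet> (y T - y t))) {t..T}"
      using has_integral_linear[OF Y bounded_linear_inner_right[of p]] by (simp add: o_def)
    moreover have "((\<lambda>s. \<delta> s * l (velocity p s)) has_integral running_cost p) {t..T}"
      unfolding running_cost_def
      by (intro integrable_integral integrable_continuous_interval continuous_lagrangian)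
    ultimately have "((\<lambda>s. \<delta> s * l (velocity p s) + (p \<bullet> Y s - p \<bullet> velocity p s)) has_integral
        (running_cost p + (p \<bullet> (y T - y t) - p \<bullet> displacement p))) {t..T}"
      by (intro has_integral_add has_integral_diff inner_displacement)
    \<comment> \<open>The bracket vanishes because \<open>y\<close> has displacement
      \<open>displacement p\<close>.\<close>
    then have "running_cost p + (p \<bullet> (y T - y t) - p \<bullet> displacement p) \<le> (LINT s:{t..T}|lebesgue. I s)"
    proof (rule has_integral_le[OF _ I])
      fix s assume s: "s \<in> {t..T}"
      have "l (velocity p s) + (inverse (\<delta> s) *\<^sub>R p) \<bullet> (Y s - velocity p s) \<le> l (Y s)"
        using tangent_le[of "velocity p s" "Y s"] by (simp add: velocity_def gradient_\<iota>)
      then have "\<delta> s * (l (velocity p s) + (inverse (\<delta> s) *\<^sub>R p) \<bullet> (Y s - velocity p s)) \<le> I s"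
        unfolding I_def using \<delta>_pos[OF s] by (intro mult_left_mono) auto
      then show "\<delta> s * l (velocity p s) + (p \<bullet> Y s - p \<bullet> velocity p s) \<le> I s"
        using \<delta>_pos[OF s] by (simp add: distrib_left mult.assoc[symmetric] flip: inner_diff_right)
    qed
    then have "running_cost p \<le> (LINT s:{t..T}|lebesgue. I s)" by (simp add: p)
    also have "ereal \<dots> = ext_lebesgue_integral {t..T} I"
      using True by (simp add: ext_lebesgue_integral_eq)
    finally show ?thesis by (simp add: I_def[abs_def] Y_def)
  qed
qed

end

section \<open>The value function as a minimum over \<open>p\<close>\<close>

theorem theorem3p1:
  fixes l g :: "real ^ 'n \<Rightarrow> real"
    and d :: "real \<Rightarrow> real \<Rightarrow> real"
    and a T t :: real
    and x :: "real ^ 'n"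
  assumes "0 < T"
    and "twice_continuously_differentiable l"
    and "strictly_convex l"
    and "filterlim (\<lambda>u. l u / norm u) at_top at_infinity"
    and "\<exists>L. L-lipschitz_on UNIV g"
    and "0 < a"
    and "\<And>r s. r \<in> {0..T} \<Longrightarrow> s \<in> {0..T} \<Longrightarrow> d r s \<in> {a<..1}"
    and "\<exists>L. L-lipschitz_on ({0..T} \<times> {0..T}) (\<lambda>(r, s). d r s)"
    and "\<And>r. r \<in> {0..T} \<Longrightarrow> d r r = 1"
    and "0 \<le> t" and "t < T"
  shows "\<exists>p. is_arg_min (hopf_lax_objective T l g d x t) (\<lambda>_. True) p \<and>
             value_function T l g d x t = ereal (hopf_lax_objective T l g d x t p)"
proof -
  have "continuous_on ({0..T} \<times> {0..T}) (\<lambda>(r, s). d r s)"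
    using assms(8) lipschitz_on_continuous_on by blast
  \<comment> \<open>Joint continuity of the discount is restricted to the slice with first argument
    \<open>t\<close>.\<close>
  then have "continuous_on {t..T} (\<lambda>s. case (t, s) of (r, s) \<Rightarrow> d r s)"
    by (rule continuous_on_compose2) (use assms(10,11) in \<open>auto intro!: continuous_intros\<close>)
  then interpret discounted_superlinear_convex l "d t" t T a
    using assms(2,3,4,6,7,10,11)
    by unfold_locales (auto intro: less_imp_le simp: greaterThanAtMost_iff)
  have objective: "hopf_lax_objective T l g d x t p = running_cost p + d t T * g (x + displacement p)" for p
  proof -
    have "(LINT s:{t..T}|lebesgue. d t s * l (velocity p s)) = running_cost p"
      unfolding running_cost_def
      by (intro set_lebesgue_integral_eq_integral absolutely_integrable_continuous_real continuous_lagrangian)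
    moreover have "(LINT s:{t..T}|lebesgue. velocity p s) = displacement p"
      unfolding displacement_def
      by (intro set_lebesgue_integral_eq_integral absolutely_integrable_continuous_real continuous_velocity)
    ultimately show ?thesis
      by (simp add: hopf_lax_objective_def velocity_def \<iota>_def)
  qed
  obtain L where "L-lipschitz_on UNIV g" using assms(5) by blast
  then obtain p where p: "\<And>q. hopf_lax_objective T l g d x t p \<le> hopf_lax_objective T l g d x t q"
    unfolding objective by (rule objective_attains_min) blast
  have "value_function T l g d x t = ereal (hopf_lax_objective T l g d x t p)"
    unfolding value_function_def
  proof (rule antisym)
    have "cost T l g d t (trajectory x p) = ereal (hopf_lax_objective T l g d x t p)"
      by (simp add: cost_def trajectory_running_cost trajectory_T objective)
    with trajectory_in_AC[of x p]
    show "(INF y\<in>AC T x t. cost T l g d t y) \<le> ereal (hopf_lax_objective T l g d x t p)"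
      by (metis INF_lower)
    show "ereal (hopf_lax_objective T l g d x t p) \<le> (INF y\<in>AC T x t. cost T l g d t y)"
    proof (rule INF_greatest)
      fix y assume "y \<in> AC T x t"
      then have y: "absolutely_continuous_on {t..T} y" "y t = x" by (auto simp: AC_def)
      \<comment> \<open>The competitor is matched to the given curve: the trajectory of
        \<open>q\<close> ends at \<open>y T\<close>, so both have the same terminal cost and only
        running costs are compared.\<close>
      obtain q where q: "y T - y t = displacement q" using surj_displacement by (metis surj_def)
      then have yT: "y T = x + displacement q" using y(2) by (simp add: algebra_simps)
      have "ereal (hopf_lax_objective T l g d x t p) \<le> ereal (running_cost q) + ereal (d t T * g (y T))"
        using p[of q] by (simp add: objective yT)
      also have "\<dots> \<le> cost T l g d t y"
        unfolding cost_def by (intro add_right_mono running_cost_le y q)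
      finally show "ereal (hopf_lax_objective T l g d x t p) \<le> cost T l g d t y" .
    qed
  qed
  with p show ?thesis by (auto simp: is_arg_min_def not_less)
qed

end
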